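(* Let $\mathbf{k}$ be a unitary commutative ring, $\Omega$ a nonempty set, $(H,\ast_H,1_H,\Delta_H,\varepsilon_H,\vee_\Omega)$ a cocycle $\vee_\Omega$-bialgebra over $\mathbf{k}$, and $C$ a coideal of $H$. Then: (a) For each $\alpha\in\Omega$, the submodule $H\vee_\alpha H$ of $H$ spanned by $\{h_1\vee_\alpha h_2\mid h_1,h_2\in H\}$ is a coideal of $H$. (b) The ideal of $H$ generated by $C$ is a biideal of $H$.
   Context: All modules, algebras, coalgebras, bialgebras, linear maps and tensor products are over $\mathbf{k}$; algebras are associative and unitary but not necessarily commutative; "ideal" means two-sided ideal. A $\vee_\Omega$-algebra $(A,\ast_A,1_A,\vee_\Omega)$ is an algebra $(A,\ast_A,1_A)$ with a set of binary operations (linear maps) $\vee_\alpha:A\otimes A\to A$, $\alpha\in\Omega$, such that for all $\alpha,\alpha'\in\Omega$ and $a=a_1\vee_\alpha a_2$, $a'=a_1'\vee_{\alpha'}a_2'$ (with $a_1,a_2,a_1',a_2'\in A$), $a\ast_A a'=a_1\vee_\alpha(a_2\ast_A a')+(a\ast_A a_1')\vee_{\alpha'}a_2'$. A cocycle $\vee_\Omega$-bialgebra is a bialgebra $(H,\ast_H,1_H,\Delta_H,\varepsilon_H)$ which is also a $\vee_\Omega$-algebra $(H,\ast_H,1_H,\vee_\Omega)$ and satisfies, for all $\alpha\in\Omega$ and $h,h'\in H$, $$\Delta_H(h\vee_\alpha h')=(h\vee_\alpha h')\otimes1_H+(\ast_H,\vee_\alpha)\bigl(\Delta_H(h)\otimes\Delta_H(h')\bigr),$$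 where $(\ast_H,\vee_\alpha)=(\ast_H\otimes\vee_\alpha)\circ\tau_{23}$ and $\tau_{23}$ exchanges the second and third tensor factors. A submodule $I$ of a coalgebra $(D,\Delta,\varepsilon)$ is a coideal if $I\subseteq\ker\varepsilon$ and $\Delta(I)\subseteq I\otimes D+D\otimes I$ (meaning the sum of the images of $I\otimes D$ and $D\otimes I$ in $D\otimes D$). A biideal of a bialgebra is a submodule which is both an ideal and a coideal. *)

theory Defs
  imports "HOL-Algebra.Module" "HOL-Algebra.RingHom"
begin

text \<open>
  Modules and algebras are carried by records of type \<^typ>\<open>('k, 'a) module\<close>; the fields \<open>mult\<close> and
  \<open>one\<close> are irrelevant when the record is only used as a module.
\<close>

section \<open>Modules and linear maps\<close>

definition linear_map ::
    "('k, 'r) ring_scheme \<Rightarrow> ('k, 'a, 'm) module_scheme \<Rightarrow> ('k, 'b, 'n) module_scheme \<Rightarrow> ('a \<Rightarrow> 'b) \<Rightarrow> bool"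
  where "linear_map R M N f \<longleftrightarrow>
    f \<in> carrier M \<rightarrow> carrier N \<and>
    (\<forall>x\<in>carrier M. \<forall>y\<in>carrier M. f (x \<oplus>\<^bsub>M\<^esub> y) = f x \<oplus>\<^bsub>N\<^esub> f y) \<and>
    (\<forall>r\<in>carrier R. \<forall>x\<in>carrier M. f (r \<odot>\<^bsub>M\<^esub> x) = r \<odot>\<^bsub>N\<^esub> f x)"

definition bilinear_map ::
    "('k, 'r) ring_scheme \<Rightarrow> ('k, 'a, 'm) module_scheme \<Rightarrow> ('k, 'b, 'n) module_scheme \<Rightarrow>
      ('k, 'c, 'p) module_scheme \<Rightarrow> ('a \<Rightarrow> 'b \<Rightarrow> 'c) \<Rightarrow> bool"
  where "bilinear_map R M N P f \<longleftrightarrow>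
    (\<forall>x\<in>carrier M. linear_map R N P (\<lambda>y. f x y)) \<and>
    (\<forall>y\<in>carrier N. linear_map R M P (\<lambda>x. f x y))"

definition module_span :: "('k, 'r) ring_scheme \<Rightarrow> ('k, 'a, 'm) module_scheme \<Rightarrow> 'a set \<Rightarrow> 'a set"
  where "module_span R M S = \<Inter>{N. submodule N R M \<and> S \<subseteq> N}"

definition self_module :: "('k, 'r) ring_scheme \<Rightarrow> ('k, 'k) module"
  where "self_module R =
    \<lparr>carrier = carrier R, mult = mult R, one = one R, zero = zero R, add = add R, smult = mult R\<rparr>"

definition quot_module :: "('k, 'a, 'm) module_scheme \<Rightarrow> 'a set \<Rightarrow> ('k, 'a set) module"
  where "quot_module M N =
    \<lparr>carrier = a_rcosets\<^bsub>M\<^esub> N, mult = undefined, one = undefined, zero = N, add = set_add M,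
     smult = (\<lambda>r X. \<Union>x\<in>X. N +>\<^bsub>M\<^esub> (r \<odot>\<^bsub>M\<^esub> x))\<rparr>"

definition free_module :: "('k, 'r) ring_scheme \<Rightarrow> 'a set \<Rightarrow> ('k, 'a \<Rightarrow> 'k) module"
  where "free_module R A =
    \<lparr>carrier = {u. (\<forall>a. u a \<in> carrier R) \<and> (\<forall>a. a \<notin> A \<longrightarrow> u a = \<zero>\<^bsub>R\<^esub>) \<and> finite {a. u a \<noteq> \<zero>\<^bsub>R\<^esub>}},
     mult = undefined, one = undefined, zero = (\<lambda>a. \<zero>\<^bsub>R\<^esub>), add = (\<lambda>u v a. u a \<oplus>\<^bsub>R\<^esub> v a),
     smult = (\<lambda>r u a. r \<otimes>\<^bsub>R\<^esub> u a)\<rparr>"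

definition free_gen :: "('k, 'r) ring_scheme \<Rightarrow> 'a \<Rightarrow> 'a \<Rightarrow> 'k"
  where "free_gen R a = (\<lambda>b. if b = a then \<one>\<^bsub>R\<^esub> else \<zero>\<^bsub>R\<^esub>)"


section \<open>Tensor products\<close>

text \<open>
  \<open>M \<otimes> N\<close> is the free module on \<open>M \<times> N\<close> modulo the submodule spanned by the bilinearity relations.
\<close>

definition tensor_rels ::
    "('k, 'r) ring_scheme \<Rightarrow> ('k, 'a, 'm) module_scheme \<Rightarrow> ('k, 'b, 'n) module_scheme \<Rightarrow> ('a \<times> 'b \<Rightarrow> 'k) set"
  where "tensor_rels R M N = (let F = free_module R (carrier M \<times> carrier N); g = free_gen R in
    {g (x \<oplus>\<^bsub>M\<^esub> x', y) \<ominus>\<^bsub>F\<^esub> (g (x, y) \<oplus>\<^bsub>F\<^esub> g (x', y)) | x x' y.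
        x \<in> carrier M \<and> x' \<in> carrier M \<and> y \<in> carrier N} \<union>
    {g (x, y \<oplus>\<^bsub>N\<^esub> y') \<ominus>\<^bsub>F\<^esub> (g (x, y) \<oplus>\<^bsub>F\<^esub> g (x, y')) | x y y'.
        x \<in> carrier M \<and> y \<in> carrier N \<and> y' \<in> carrier N} \<union>
    {g (r \<odot>\<^bsub>M\<^esub> x, y) \<ominus>\<^bsub>F\<^esub> r \<odot>\<^bsub>F\<^esub> g (x, y) | r x y.
        r \<in> carrier R \<and> x \<in> carrier M \<and> y \<in> carrier N} \<union>
    {g (x, r \<odot>\<^bsub>N\<^esub> y) \<ominus>\<^bsub>F\<^esub> r \<odot>\<^bsub>F\<^esub> g (x, y) | r x y.
        r \<in> carrier R \<and> x \<in> carrier M \<and> y \<in> carrier N})"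

definition tensor_null ::
    "('k, 'r) ring_scheme \<Rightarrow> ('k, 'a, 'm) module_scheme \<Rightarrow> ('k, 'b, 'n) module_scheme \<Rightarrow> ('a \<times> 'b \<Rightarrow> 'k) set"
  where "tensor_null R M N =
    module_span R (free_module R (carrier M \<times> carrier N)) (tensor_rels R M N)"

definition tensor ::
    "('k, 'r) ring_scheme \<Rightarrow> ('k, 'a, 'm) module_scheme \<Rightarrow> ('k, 'b, 'n) module_scheme \<Rightarrow>
      ('k, ('a \<times> 'b \<Rightarrow> 'k) set) module"
  where "tensor R M N =
    quot_module (free_module R (carrier M \<times> carrier N)) (tensor_null R M N)"

definition tens ::
    "('k, 'r) ring_scheme \<Rightarrow> ('k, 'a, 'm) module_scheme \<Rightarrow> ('k, 'b, 'n) module_scheme \<Rightarrow>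
      'a \<Rightarrow> 'b \<Rightarrow> ('a \<times> 'b \<Rightarrow> 'k) set"
  where "tens R M N x y =
    tensor_null R M N +>\<^bsub>free_module R (carrier M \<times> carrier N)\<^esub> free_gen R (x, y)"

text \<open>
  The linear extension of \<open>f\<close> to formal sums. When \<open>f\<close> is bilinear it is constant on the cosets that
  make up \<open>M \<otimes> N\<close>; its value on them is the linear map \<open>M \<otimes> N \<rightarrow> P\<close> sending \<open>x \<otimes> y\<close> to \<open>f x y\<close>
  (lemma \<open>tensor_lift_universal\<close>).
\<close>

definition free_ext ::
    "('k, 'r) ring_scheme \<Rightarrow> ('k, 'c, 'p) module_scheme \<Rightarrow> ('a \<Rightarrow> 'c) \<Rightarrow> ('a \<Rightarrow> 'k) \<Rightarrow> 'c"
  where "free_ext R P f u = (\<Oplus>\<^bsub>P\<^esub>a\<in>{a. u a \<noteq> \<zero>\<^bsub>R\<^esub>}. u a \<odot>\<^bsub>P\<^esub> f a)"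

definition tensor_lift ::
    "('k, 'r) ring_scheme \<Rightarrow> ('k, 'c, 'p) module_scheme \<Rightarrow> ('a \<Rightarrow> 'b \<Rightarrow> 'c) \<Rightarrow>
      ('a \<times> 'b \<Rightarrow> 'k) set \<Rightarrow> 'c"
  where "tensor_lift R P f X = the_elem (free_ext R P (\<lambda>(x, y). f x y) ` X)"

subsection \<open>The universal property\<close>

lemma free_module_simps [simp]:
  "u \<in> carrier (free_module R A) \<longleftrightarrow> (\<forall>a. u a \<in> carrier R) \<and> (\<forall>a. a \<notin> A \<longrightarrow> u a = \<zero>\<^bsub>R\<^esub>) \<and> finite {a. u a \<noteq> \<zero>\<^bsub>R\<^esub>}"
  "\<zero>\<^bsub>free_module R A\<^esub> = (\<lambda>a. \<zero>\<^bsub>R\<^esub>)"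
  "u \<oplus>\<^bsub>free_module R A\<^esub> v = (\<lambda>a. u a \<oplus>\<^bsub>R\<^esub> v a)"
  "r \<odot>\<^bsub>free_module R A\<^esub> u = (\<lambda>a. r \<otimes>\<^bsub>R\<^esub> u a)"
  by (auto simp: free_module_def)

lemma free_module_module:
  fixes A :: "'x set"
  assumes "cring R" shows "module R (free_module R A)"
proof -
  interpret cring R by fact
  have fin: "finite {a. u a \<oplus>\<^bsub>R\<^esub> v a \<noteq> \<zero>\<^bsub>R\<^esub>}" if "finite {a. u a \<noteq> \<zero>\<^bsub>R\<^esub>}" "finite {a. v a \<noteq> \<zero>\<^bsub>R\<^esub>}" for u v :: "'x \<Rightarrow> _"
    by (rule finite_subset[OF _ finite_UnI[OF that]]) auto
  have fin2: "finite {a. r \<otimes>\<^bsub>R\<^esub> u a \<noteq> \<zero>\<^bsub>R\<^esub>}" if "finite {a. u a \<noteq> \<zero>\<^bsub>R\<^esub>}" "r \<in> carrier R" for u :: "'x \<Rightarrow> _" and r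
    by (rule finite_subset[OF _ that(1)]) (use that in auto)
  show ?thesis
  proof (rule moduleI)
    show "abelian_group (free_module R A)"
    proof (rule abelian_groupI)
      fix x assume x: "x \<in> carrier (free_module R A)"
      have "(\<lambda>a. \<ominus>\<^bsub>R\<^esub> x a) \<in> carrier (free_module R A)"
        using x by (auto elim: rev_finite_subset)
      moreover have "(\<lambda>a. \<ominus>\<^bsub>R\<^esub> x a) \<oplus>\<^bsub>free_module R A\<^esub> x = \<zero>\<^bsub>free_module R A\<^esub>"
        using x by (auto simp: l_neg)
      ultimately show "\<exists>y\<in>carrier (free_module R A). y \<oplus>\<^bsub>free_module R A\<^esub> x = \<zero>\<^bsub>free_module R A\<^esub>" by blast
    next
      fix x y assume "x \<in> carrier (free_module R A)" "y \<in> carrier (free_module R A)"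
      then show "x \<oplus>\<^bsub>free_module R A\<^esub> y = y \<oplus>\<^bsub>free_module R A\<^esub> x"
        by (auto intro: ext a_comm)
    qed (auto simp: fin a_assoc)
  qed (auto simp: fin2 assms l_distr r_distr m_assoc)
qed

lemma span_submodule:
  assumes "module R M" "S \<subseteq> carrier M"
  shows "submodule (module_span R M S) R M" "S \<subseteq> module_span R M S"
proof -
  interpret module R M by fact
  show "submodule (module_span R M S) R M"
  proof (rule submoduleI)
    show "module_span R M S \<subseteq> carrier M"
      using carrier_is_submodule assms(2) by (auto simp: module_span_def)
    show "\<zero>\<^bsub>M\<^esub> \<in> module_span R M S"
      using subgroup.one_closed[OF submodule.axioms(1)] by (fastforce simp: module_span_def)
  qed (auto simp: module_span_def submodule.smult_closed submoduleE(3,5))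
  show "S \<subseteq> module_span R M S" by (auto simp: module_span_def)
qed

lemma quot_module_module:
  assumes "module R M" "submodule N R M"
  shows "module R (quot_module M N)" "linear_map R M (quot_module M N) (\<lambda>x. N +>\<^bsub>M\<^esub> x)"
     "r \<in> carrier R \<Longrightarrow> x \<in> carrier M \<Longrightarrow> (r \<odot>\<^bsub>quot_module M N\<^esub> (N +>\<^bsub>M\<^esub> x)) = N +>\<^bsub>M\<^esub> (r \<odot>\<^bsub>M\<^esub> x)"
proof -
  interpret module R M by fact
  interpret N: abelian_subgroup N M
    using assms(2) by (intro abelian_subgroupI3 additive_subgroup.intro M.abelian_group_axioms submodule.axioms(1))
  have cos: "N +>\<^bsub>M\<^esub> x \<in> carrier (quot_module M N)" if "x \<in> carrier M" for x
    using that by (auto simp: quot_module_def A_RCOSETS_def')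
  have car: "X \<in> carrier (quot_module M N) \<longleftrightarrow> (\<exists>x\<in>carrier M. X = N +>\<^bsub>M\<^esub> x)" for X
    by (auto simp: quot_module_def A_RCOSETS_def')
  have add: "(N +>\<^bsub>M\<^esub> x) \<oplus>\<^bsub>quot_module M N\<^esub> (N +>\<^bsub>M\<^esub> y) = N +>\<^bsub>M\<^esub> (x \<oplus>\<^bsub>M\<^esub> y)" if "x \<in> carrier M" "y \<in> carrier M" for x y
    using that by (simp add: quot_module_def N.a_rcos_sum)
  have sm: "(r \<odot>\<^bsub>quot_module M N\<^esub> (N +>\<^bsub>M\<^esub> x)) = N +>\<^bsub>M\<^esub> (r \<odot>\<^bsub>M\<^esub> x)" if r: "r \<in> carrier R" and x: "x \<in> carrier M" for r x
  proof -
    have "N +>\<^bsub>M\<^esub> (r \<odot>\<^bsub>M\<^esub> y) = N +>\<^bsub>M\<^esub> (r \<odot>\<^bsub>M\<^esub> x)" if "y \<in> N +>\<^bsub>M\<^esub> x" for y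
    proof -
      from that obtain n where n: "n \<in> N" "y = n \<oplus>\<^bsub>M\<^esub> x" by (auto simp: a_r_coset_def')
      have nc: "n \<in> carrier M" using n by auto
      have "r \<odot>\<^bsub>M\<^esub> y = r \<odot>\<^bsub>M\<^esub> n \<oplus>\<^bsub>M\<^esub> r \<odot>\<^bsub>M\<^esub> x" using n r x nc smult_r_distr by auto
      moreover have "r \<odot>\<^bsub>M\<^esub> n \<in> N" using assms(2) n r by (simp add: submodule.smult_closed)
      ultimately have "r \<odot>\<^bsub>M\<^esub> y \<in> N +>\<^bsub>M\<^esub> (r \<odot>\<^bsub>M\<^esub> x)" by (auto simp: a_r_coset_def')
      then show ?thesis using M.a_repr_independence'[folded a_r_coset_def, OF _ smult_closed[OF r x] N.a_subgroup] by simp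
    qed
    moreover have "x \<in> N +>\<^bsub>M\<^esub> x" using x by (simp add: N.a_rcos_self)
    ultimately have "(\<Union>y\<in>N +>\<^bsub>M\<^esub> x. N +>\<^bsub>M\<^esub> (r \<odot>\<^bsub>M\<^esub> y)) = N +>\<^bsub>M\<^esub> (r \<odot>\<^bsub>M\<^esub> x)"
      by (intro UN_constant_eq) blast+
    then show ?thesis by (simp add: quot_module_def)
  qed
  show "r \<in> carrier R \<Longrightarrow> x \<in> carrier M \<Longrightarrow> (r \<odot>\<^bsub>quot_module M N\<^esub> (N +>\<^bsub>M\<^esub> x)) = N +>\<^bsub>M\<^esub> (r \<odot>\<^bsub>M\<^esub> x)" by (rule sm)
  show "linear_map R M (quot_module M N) (\<lambda>x. N +>\<^bsub>M\<^esub> x)"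
    by (auto simp: linear_map_def cos add sm)
  have z: "\<zero>\<^bsub>quot_module M N\<^esub> = N +>\<^bsub>M\<^esub> \<zero>\<^bsub>M\<^esub>" by (simp add: quot_module_def N.a_subset)
  show "module R (quot_module M N)"
  proof (rule moduleI)
    show "abelian_group (quot_module M N)"
    proof (rule abelian_groupI)
      fix X assume "X \<in> carrier (quot_module M N)"
      then obtain x where x: "x \<in> carrier M" "X = N +>\<^bsub>M\<^esub> x" by (auto simp: car)
      show "\<exists>y\<in>carrier (quot_module M N). y \<oplus>\<^bsub>quot_module M N\<^esub> X = \<zero>\<^bsub>quot_module M N\<^esub>"
        by (rule bexI[of _ "N +>\<^bsub>M\<^esub> (\<ominus>\<^bsub>M\<^esub> x)"]) (use x in \<open>auto simp: add cos M.l_neg z\<close>)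
    qed (auto dest!: car[THEN iffD1] simp: add z M.a_ac cos)
  qed (auto dest!: car[THEN iffD1] simp: add sm cos R.is_cring smult_l_distr smult_r_distr smult_assoc1)
qed

lemma free_gen_closed: "cring R \<Longrightarrow> a \<in> A \<Longrightarrow> free_gen R a \<in> carrier (free_module R A)"
proof -
  assume "cring R" and a: "a \<in> A"
  interpret cring R by fact
  show ?thesis using a by (auto simp: free_gen_def intro: finite_subset[of _ "{a}"])
qed

lemma free_ext_superset:
  assumes "module R P" "f \<in> A \<rightarrow> carrier P" "u \<in> carrier (free_module R A)" "finite S" "{a. u a \<noteq> \<zero>\<^bsub>R\<^esub>} \<subseteq> S" "S \<subseteq> A"
  shows "free_ext R P f u = (\<Oplus>\<^bsub>P\<^esub>a\<in>S. u a \<odot>\<^bsub>P\<^esub> f a)"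
proof -
  interpret module R P by fact
  show ?thesis unfolding free_ext_def
    by (rule M.add.finprod_mono_neutral_cong_left) (use assms in \<open>auto simp: Pi_def\<close>)
qed

lemma free_ext_linear:
  assumes "module R P" "f \<in> A \<rightarrow> carrier P"
  shows "linear_map R (free_module R A) P (free_ext R P f)"
proof -
  interpret module R P by fact
  interpret F: module R "free_module R A" by (rule free_module_module) (rule R.is_cring)
  show ?thesis unfolding linear_map_def
  proof (intro conjI ballI funcsetI)
    fix u assume u: "u \<in> carrier (free_module R A)"
    show "free_ext R P f u \<in> carrier P" unfolding free_ext_def
      by (rule M.finsum_closed) (use u assms(2) in \<open>auto simp: Pi_def\<close>)
  next
    fix u v assume u: "u \<in> carrier (free_module R A)" and v: "v \<in> carrier (free_module R A)"
    let ?S = "{a. u a \<noteq> \<zero>\<^bsub>R\<^esub>} \<union> {a. v a \<noteq> \<zero>\<^bsub>R\<^esub>}"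
    have uv: "u \<oplus>\<^bsub>free_module R A\<^esub> v \<in> carrier (free_module R A)" using u v by (rule F.M.a_closed)
    have S: "finite ?S" "?S \<subseteq> A" using u v by auto
    have 1: "{a. u a \<noteq> \<zero>\<^bsub>R\<^esub>} \<subseteq> ?S" "{a. v a \<noteq> \<zero>\<^bsub>R\<^esub>} \<subseteq> ?S" "{a. (u \<oplus>\<^bsub>free_module R A\<^esub> v) a \<noteq> \<zero>\<^bsub>R\<^esub>} \<subseteq> ?S"
      by (auto)
    have fS: "f a \<in> carrier P" if "a \<in> ?S" for a using S that assms by auto
    have c: "u a \<in> carrier R" "v a \<in> carrier R" for a using u v by auto
    show "free_ext R P f (u \<oplus>\<^bsub>free_module R A\<^esub> v) = free_ext R P f u \<oplus>\<^bsub>P\<^esub> free_ext R P f v"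
      unfolding free_ext_superset[OF assms u S(1) 1(1) S(2)] free_ext_superset[OF assms v S(1) 1(2) S(2)]
        free_ext_superset[OF assms uv S(1) 1(3) S(2)]
      apply (subst M.finsum_addf[symmetric])
      using fS c apply blast
      using fS c apply blast
      apply (rule M.finsum_cong')
      using fS c apply (auto simp: smult_l_distr)
      done
  next
    fix r u assume r: "r \<in> carrier R" and u: "u \<in> carrier (free_module R A)"
    let ?S = "{a. u a \<noteq> \<zero>\<^bsub>R\<^esub>}"
    have uv: "r \<odot>\<^bsub>free_module R A\<^esub> u \<in> carrier (free_module R A)" using r u by (rule F.smult_closed)
    have S: "finite ?S" "?S \<subseteq> A" using u by auto
    have 1: "{a. (r \<odot>\<^bsub>free_module R A\<^esub> u) a \<noteq> \<zero>\<^bsub>R\<^esub>} \<subseteq> ?S"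
      using r by (auto)
    have fS: "f a \<in> carrier P" if "a \<in> ?S" for a using S that assms by auto
    have c: "u a \<in> carrier R" for a using u by auto
    show "free_ext R P f (r \<odot>\<^bsub>free_module R A\<^esub> u) = r \<odot>\<^bsub>P\<^esub> free_ext R P f u"
      unfolding free_ext_superset[OF assms u S(1) order_refl S(2)] 
        free_ext_superset[OF assms uv S(1) 1 S(2)]
      apply (subst finsum_smult_ldistr)
      using fS c r S apply (auto intro!: M.finsum_cong' simp: smult_assoc1)
      done
  qed
qed

lemma free_ext_gen:
  assumes "module R P" "f \<in> A \<rightarrow> carrier P" "a \<in> A"
  shows "free_ext R P f (free_gen R a) = f a"
proof -
  interpret module R P by fact
  have "free_ext R P f (free_gen R a) = (\<Oplus>\<^bsub>P\<^esub>b\<in>{a}. free_gen R a b \<odot>\<^bsub>P\<^esub> f b)"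
    by (rule free_ext_superset[OF assms(1,2) free_gen_closed]) (use assms R.is_cring in \<open>auto simp: free_gen_def\<close>)
  also have "\<dots> = f a" using assms funcset_mem[OF assms(2,3)] by (subst M.finsum_insert) (auto simp: free_gen_def)
  finally show ?thesis .
qed

lemma linear_minus:
  assumes "module R M" "module R N" "linear_map R M N f" "x \<in> carrier M" "y \<in> carrier M"
  shows "f (x \<ominus>\<^bsub>M\<^esub> y) = f x \<ominus>\<^bsub>N\<^esub> f y"
proof -
  interpret M: module R M by fact
  interpret N: module R N by fact
  have "f (\<ominus>\<^bsub>M\<^esub> y) = f ((\<ominus>\<^bsub>R\<^esub> \<one>\<^bsub>R\<^esub>) \<odot>\<^bsub>M\<^esub> y)" using assms by (simp add: M.smult_l_minus)
  also have "\<dots> = (\<ominus>\<^bsub>R\<^esub> \<one>\<^bsub>R\<^esub>) \<odot>\<^bsub>N\<^esub> f y" using assms unfolding linear_map_def by (meson M.R.a_inv_closed M.R.one_closed)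
  also have "\<dots> = \<ominus>\<^bsub>N\<^esub> f y" using assms funcset_mem[of f "carrier M" "carrier N" y] unfolding linear_map_def by (simp add: N.smult_l_minus)
  finally show ?thesis using assms unfolding linear_map_def a_minus_def by simp
qed

lemma linear_ker:
  assumes "module R M" "module R N" "linear_map R M N f"
  shows "submodule {x \<in> carrier M. f x = \<zero>\<^bsub>N\<^esub>} R M"
proof -
  interpret M: module R M by fact
  interpret N: module R N by fact
  have z: "f \<zero>\<^bsub>M\<^esub> = \<zero>\<^bsub>N\<^esub>" 
    using linear_minus[OF assms M.M.zero_closed M.M.zero_closed] assms(3) unfolding linear_map_def
    by (metis M.M.r_zero M.M.zero_closed N.M.add.r_cancel_one PiE)
  show ?thesis
    apply (rule M.submoduleI)
    using assms(3) z linear_minus[OF assms M.M.zero_closed] unfolding linear_map_def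
    by (auto simp: a_minus_def)
qed

lemma tensor_rels_closed:
  assumes "module R M" "module R N"
  shows "tensor_rels R M N \<subseteq> carrier (free_module R (carrier M \<times> carrier N))"
proof -
  interpret M: module R M by fact
  interpret N: module R N by fact
  interpret F: module R "free_module R (carrier M \<times> carrier N)" by (rule free_module_module) (rule M.R.is_cring)
  have g: "free_gen R (x,y) \<in> carrier (free_module R (carrier M \<times> carrier N))" if "x \<in> carrier M" "y \<in> carrier N" for x y
    by (rule free_gen_closed) (use that M.R.is_cring in auto)
  show ?thesis
    unfolding tensor_rels_def Let_def
    by (auto simp del: free_module_simps intro!: F.M.minus_closed F.M.a_closed F.smult_closed g)
qed

lemma tensor_module:
  assumes "module R M" "module R N"
  shows "module R (tensor R M N)"
  unfolding tensor_def tensor_null_def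
  using assms
  by (intro quot_module_module(1) span_submodule(1) tensor_rels_closed free_module_module) (auto simp: module_def)

lemma tens_bilinear:
  assumes "module R M" "module R N"
  shows "bilinear_map R M N (tensor R M N) (tens R M N)"
proof -
  interpret M: module R M by fact
  interpret N: module R N by fact
  define F where "F = free_module R (carrier M \<times> carrier N)"
  interpret F: module R F unfolding F_def by (rule free_module_module) (rule M.R.is_cring)
  have g: "free_gen R (x,y) \<in> carrier F" if "x \<in> carrier M" "y \<in> carrier N" for x y
    unfolding F_def by (rule free_gen_closed) (use that M.R.is_cring in auto)
  let ?K = "tensor_null R M N"
  have sub: "submodule ?K R F" and inc: "tensor_rels R M N \<subseteq> ?K"
    unfolding tensor_null_def F_def[symmetric]
    by (use span_submodule[OF F.module_axioms] tensor_rels_closed[OF assms] in \<open>auto simp: F_def\<close>)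
  interpret K: abelian_subgroup ?K F
    using sub by (intro abelian_subgroupI3 additive_subgroup.intro F.M.abelian_group_axioms submodule.axioms(1))
  have lin: "linear_map R F (tensor R M N) (\<lambda>x. ?K +>\<^bsub>F\<^esub> x)"
    unfolding tensor_def F_def[symmetric]
    by (rule quot_module_module(2)) (use sub F.module_axioms in auto)
  have eq: "?K +>\<^bsub>F\<^esub> u = ?K +>\<^bsub>F\<^esub> v" if "u \<ominus>\<^bsub>F\<^esub> v \<in> tensor_rels R M N" "u \<in> carrier F" "v \<in> carrier F" for u v
  proof -
    have "u \<in> ?K +>\<^bsub>F\<^esub> v" 
      by (rule K.a_rcos_module_rev[OF that(3,2)]) (use that(1) inc in \<open>auto simp: a_minus_def\<close>)
    from F.M.a_repr_independence'[folded a_r_coset_def, OF this that(3) K.a_subgroup] show ?thesis by simp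
  qed
  have T: "tens R M N x y = ?K +>\<^bsub>F\<^esub> free_gen R (x,y)" for x y by (simp add: tens_def F_def)
  show ?thesis
    unfolding bilinear_map_def linear_map_def
  proof (intro conjI ballI funcsetI)
  fix x y assume xy: "x \<in> carrier M" "y \<in> carrier N"
  show c: "tens R M N x y \<in> carrier (tensor R M N)" "tens R M N x y \<in> carrier (tensor R M N)"
    using lin g[OF xy] unfolding T linear_map_def by auto
  { fix y' assume "y' \<in> carrier N" 
    then have "tens R M N x (y \<oplus>\<^bsub>N\<^esub> y') = ?K +>\<^bsub>F\<^esub> (free_gen R (x,y) \<oplus>\<^bsub>F\<^esub> free_gen R (x,y'))"
      unfolding T by (intro eq) (use xy g in \<open>auto simp: tensor_rels_def Let_def F_def[symmetric]\<close>)
    then show "tens R M N x (y \<oplus>\<^bsub>N\<^esub> y') = tens R M N x y \<oplus>\<^bsub>tensor R M N\<^esub> tens R M N x y'"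
      using lin g \<open>y' \<in> carrier N\<close> xy unfolding T linear_map_def by auto }
  { fix x' assume "x' \<in> carrier M" 
    then have "tens R M N (x \<oplus>\<^bsub>M\<^esub> x') y = ?K +>\<^bsub>F\<^esub> (free_gen R (x,y) \<oplus>\<^bsub>F\<^esub> free_gen R (x',y))"
      unfolding T by (intro eq) (use xy g in \<open>auto simp: tensor_rels_def Let_def F_def[symmetric]\<close>)
    then show "tens R M N (x \<oplus>\<^bsub>M\<^esub> x') y = tens R M N x y \<oplus>\<^bsub>tensor R M N\<^esub> tens R M N x' y"
      using lin g \<open>x' \<in> carrier M\<close> xy unfolding T linear_map_def by auto }
  next
  fix x y r assume xy: "r \<in> carrier R" "x \<in> carrier M" "y \<in> carrier N"
    have "tens R M N (r \<odot>\<^bsub>M\<^esub> x) y = ?K +>\<^bsub>F\<^esub> (r \<odot>\<^bsub>F\<^esub> free_gen R (x,y))"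
      unfolding T by (intro eq) (use xy g in \<open>auto simp: tensor_rels_def Let_def F_def[symmetric]\<close>)
    then show "tens R M N (r \<odot>\<^bsub>M\<^esub> x) y = r \<odot>\<^bsub>tensor R M N\<^esub> tens R M N x y"
      using lin g xy unfolding T linear_map_def by auto
  next
  fix x y r assume xy: "x \<in> carrier M" "r \<in> carrier R" "y \<in> carrier N"
    have "tens R M N x (r \<odot>\<^bsub>N\<^esub> y) = ?K +>\<^bsub>F\<^esub> (r \<odot>\<^bsub>F\<^esub> free_gen R (x,y))"
      unfolding T by (intro eq) (use xy g in \<open>auto simp: tensor_rels_def Let_def F_def[symmetric]\<close>)
    then show "tens R M N x (r \<odot>\<^bsub>N\<^esub> y) = r \<odot>\<^bsub>tensor R M N\<^esub> tens R M N x y"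
      using lin g xy unfolding T linear_map_def by auto
  qed
qed

lemma tensor_lift_universal:
  assumes "module R M" "module R N" "module R P" and bil: "bilinear_map R M N P f"
  shows "linear_map R (tensor R M N) P (tensor_lift R P f)"
    and "x \<in> carrier M \<Longrightarrow> y \<in> carrier N \<Longrightarrow> tensor_lift R P f (tens R M N x y) = f x y"
proof -
  interpret M: module R M by fact
  interpret N: module R N by fact
  interpret P: module R P by fact
  define F where "F = free_module R (carrier M \<times> carrier N)"
  interpret F: module R F unfolding F_def by (rule free_module_module) (rule M.R.is_cring)
  have g: "free_gen R (x,y) \<in> carrier F" if "x \<in> carrier M" "y \<in> carrier N" for x y
    unfolding F_def by (rule free_gen_closed) (use that M.R.is_cring in auto)
  let ?K = "tensor_null R M N"
  have sub: "submodule ?K R F" and inc: "tensor_rels R M N \<subseteq> ?K"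
    unfolding tensor_null_def F_def[symmetric]
    by (use span_submodule[OF F.module_axioms] tensor_rels_closed[OF assms(1,2)] in \<open>auto simp: F_def\<close>)
  interpret K: abelian_subgroup ?K F
    using sub by (intro abelian_subgroupI3 additive_subgroup.intro F.M.abelian_group_axioms submodule.axioms(1))
  have lin: "linear_map R F (tensor R M N) (\<lambda>x. ?K +>\<^bsub>F\<^esub> x)"
    unfolding tensor_def F_def[symmetric]
    by (rule quot_module_module(2)) (use sub F.module_axioms in auto)
  let ?e = "free_ext R P (\<lambda>(x,y). f x y)"
  have fc: "(\<lambda>(x,y). f x y) \<in> carrier M \<times> carrier N \<rightarrow> carrier P"
    using bil unfolding bilinear_map_def linear_map_def by auto
  have fc': "f x y \<in> carrier P" if "x \<in> carrier M" "y \<in> carrier N" for x y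
    using funcset_mem[OF fc, of "(x,y)"] that by auto
  have e: "linear_map R F P ?e" unfolding F_def by (rule free_ext_linear[OF assms(3) fc])
  have eg: "?e (free_gen R (x,y)) = f x y" if "x \<in> carrier M" "y \<in> carrier N" for x y
    using free_ext_gen[OF assms(3) fc, of "(x,y)"] that by auto
  have em: "?e (u \<ominus>\<^bsub>F\<^esub> v) = ?e u \<ominus>\<^bsub>P\<^esub> ?e v" if "u \<in> carrier F" "v \<in> carrier F" for u v
    by (rule linear_minus[OF F.module_axioms assms(3) e that])
  have ea: "?e (u \<oplus>\<^bsub>F\<^esub> v) = ?e u \<oplus>\<^bsub>P\<^esub> ?e v" if "u \<in> carrier F" "v \<in> carrier F" for u v
    using e that unfolding linear_map_def by auto
  have es: "?e (r \<odot>\<^bsub>F\<^esub> v) = r \<odot>\<^bsub>P\<^esub> ?e v" if "r \<in> carrier R" "v \<in> carrier F" for r v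
    using e that unfolding linear_map_def by auto
  have b: "\<And>x x' y. x \<in> carrier M \<Longrightarrow> x' \<in> carrier M \<Longrightarrow> y \<in> carrier N \<Longrightarrow> f (x \<oplus>\<^bsub>M\<^esub> x') y = f x y \<oplus>\<^bsub>P\<^esub> f x' y"
     "\<And>x y r. x \<in> carrier M \<Longrightarrow> r \<in> carrier R \<Longrightarrow> y \<in> carrier N \<Longrightarrow> f (r \<odot>\<^bsub>M\<^esub> x) y = r \<odot>\<^bsub>P\<^esub> f x y"
     "\<And>x y y'. x \<in> carrier M \<Longrightarrow> y' \<in> carrier N \<Longrightarrow> y \<in> carrier N \<Longrightarrow> f x (y \<oplus>\<^bsub>N\<^esub> y') = f x y \<oplus>\<^bsub>P\<^esub> f x y'"
     "\<And>x y r. x \<in> carrier M \<Longrightarrow> r \<in> carrier R \<Longrightarrow> y \<in> carrier N \<Longrightarrow> f x (r \<odot>\<^bsub>N\<^esub> y) = r \<odot>\<^bsub>P\<^esub> f x y"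
    using bil unfolding bilinear_map_def linear_map_def by auto
  have "tensor_rels R M N \<subseteq> {u \<in> carrier F. ?e u = \<zero>\<^bsub>P\<^esub>}"
    using tensor_rels_closed[OF assms(1,2)]
    unfolding tensor_rels_def Let_def F_def[symmetric]
    by (auto simp: em ea es eg g b fc' P.M.r_neg a_minus_def[of P])
  then have K0: "?K \<subseteq> {u \<in> carrier F. ?e u = \<zero>\<^bsub>P\<^esub>}"
    unfolding tensor_null_def module_span_def F_def[symmetric] using linear_ker[OF F.module_axioms assms(3) e] by blast
  have const: "?e v = ?e u" if vu: "v \<in> ?K +>\<^bsub>F\<^esub> u" and uF: "u \<in> carrier F" for u v
  proof -
    have "?e u \<in> carrier P" using e uF unfolding linear_map_def by blast
    moreover obtain k where "k \<in> ?K" "v = k \<oplus>\<^bsub>F\<^esub> u"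
      using vu unfolding a_r_coset_def r_coset_def by auto
    moreover have "k \<in> carrier F" "?e k = \<zero>\<^bsub>P\<^esub>" using K0 \<open>k \<in> ?K\<close> by blast+
    ultimately show ?thesis using ea[of k u] uF by simp
  qed
  have L: "tensor_lift R P f (?K +>\<^bsub>F\<^esub> u) = ?e u" if "u \<in> carrier F" for u
  proof -
    show ?thesis unfolding tensor_lift_def
      by (rule the_elem_image_unique) (use K.a_rcos_self[OF that] in blast, rule const[OF _ that])
  qed
  show "x \<in> carrier M \<Longrightarrow> y \<in> carrier N \<Longrightarrow> tensor_lift R P f (tens R M N x y) = f x y"
    using L g eg by (simp add: tens_def F_def)
  have car: "X \<in> carrier (tensor R M N) \<longleftrightarrow> (\<exists>x\<in>carrier F. X = ?K +>\<^bsub>F\<^esub> x)" for X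
    by (auto simp: tensor_def F_def quot_module_def A_RCOSETS_def')
  have hom: "(?K +>\<^bsub>F\<^esub> u) \<oplus>\<^bsub>tensor R M N\<^esub> (?K +>\<^bsub>F\<^esub> v) = ?K +>\<^bsub>F\<^esub> (u \<oplus>\<^bsub>F\<^esub> v)" if "u \<in> carrier F" "v \<in> carrier F" for u v
    using lin that unfolding linear_map_def by auto
  have homs: "r \<odot>\<^bsub>tensor R M N\<^esub> (?K +>\<^bsub>F\<^esub> v) = ?K +>\<^bsub>F\<^esub> (r \<odot>\<^bsub>F\<^esub> v)" if "r \<in> carrier R" "v \<in> carrier F" for r v
    using lin that unfolding linear_map_def by auto
  show "linear_map R (tensor R M N) P (tensor_lift R P f)"
    unfolding linear_map_def
    using funcset_mem[OF conjunct1[OF e[unfolded linear_map_def]]]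
    by (auto simp: car L hom homs ea es)
qed

declare free_module_simps [simp del]


subsection \<open>Canonical maps and products\<close>

text \<open>\<open>f \<otimes> g\<close> with values in \<open>M' \<otimes> N'\<close>\<close>

definition tensor_map ::
    "('k, 'r) ring_scheme \<Rightarrow> ('k, 'c, 'm) module_scheme \<Rightarrow> ('k, 'd, 'n) module_scheme \<Rightarrow>
      ('a \<Rightarrow> 'c) \<Rightarrow> ('b \<Rightarrow> 'd) \<Rightarrow> ('a \<times> 'b \<Rightarrow> 'k) set \<Rightarrow> ('c \<times> 'd \<Rightarrow> 'k) set"
  where "tensor_map R M' N' f g =
    tensor_lift R (tensor R M' N') (\<lambda>x y. tens R M' N' (f x) (g y))"

text \<open>\<open>(M \<otimes> N) \<otimes> P \<rightarrow> M \<otimes> (N \<otimes> P)\<close>\<close>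

definition tensor_assoc ::
    "('k, 'r) ring_scheme \<Rightarrow> ('k, 'a, 'm) module_scheme \<Rightarrow> ('k, 'b, 'n) module_scheme \<Rightarrow>
      ('k, 'c, 'p) module_scheme \<Rightarrow>
      (('a \<times> 'b \<Rightarrow> 'k) set \<times> 'c \<Rightarrow> 'k) set \<Rightarrow> ('a \<times> ('b \<times> 'c \<Rightarrow> 'k) set \<Rightarrow> 'k) set"
  where "tensor_assoc R M N P = (let T = tensor R M (tensor R N P) in
    tensor_lift R T (\<lambda>t z. tensor_lift R T (\<lambda>x y. tens R M (tensor R N P) x (tens R N P y z)) t))"

text \<open>\<open>\<tau>\<^sub>2\<^sub>3 : (M \<otimes> N) \<otimes> (P \<otimes> Q) \<rightarrow> (M \<otimes> P) \<otimes> (N \<otimes> Q)\<close>\<close>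

definition tau23 ::
    "('k, 'r) ring_scheme \<Rightarrow> ('k, 'a, 'm) module_scheme \<Rightarrow> ('k, 'b, 'n) module_scheme \<Rightarrow>
      ('k, 'c, 'p) module_scheme \<Rightarrow> ('k, 'd, 'q) module_scheme \<Rightarrow>
      (('a \<times> 'b \<Rightarrow> 'k) set \<times> ('c \<times> 'd \<Rightarrow> 'k) set \<Rightarrow> 'k) set \<Rightarrow>
      (('a \<times> 'c \<Rightarrow> 'k) set \<times> ('b \<times> 'd \<Rightarrow> 'k) set \<Rightarrow> 'k) set"
  where "tau23 R M N P Q =
    (let MP = tensor R M P; NQ = tensor R N Q; T = tensor R MP NQ in
      tensor_lift R T (\<lambda>s t.
        tensor_lift R T (\<lambda>x y.
          tensor_lift R T (\<lambda>z w. tens R MP NQ (tens R M P x z) (tens R N Q y w)) t) s))"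

text \<open>
  For binary operations \<open>f\<close> on \<open>M\<close> and \<open>g\<close> on \<open>N\<close> this is \<open>(f, g) = (f \<otimes> g) \<circ> \<tau>\<^sub>2\<^sub>3\<close>, a map
  \<open>(M \<otimes> N) \<otimes> (M \<otimes> N) \<rightarrow> M \<otimes> N\<close>.
\<close>

definition tensor_op ::
    "('k, 'r) ring_scheme \<Rightarrow> ('k, 'a, 'm) module_scheme \<Rightarrow> ('k, 'b, 'n) module_scheme \<Rightarrow>
      ('a \<Rightarrow> 'a \<Rightarrow> 'a) \<Rightarrow> ('b \<Rightarrow> 'b \<Rightarrow> 'b) \<Rightarrow>
      (('a \<times> 'b \<Rightarrow> 'k) set \<times> ('a \<times> 'b \<Rightarrow> 'k) set \<Rightarrow> 'k) set \<Rightarrow> ('a \<times> 'b \<Rightarrow> 'k) set"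
  where "tensor_op R M N f g =
    tensor_map R M N (tensor_lift R M f) (tensor_lift R N g) \<circ> tau23 R M N M N"

definition tensor_algebra ::
    "('k, 'r) ring_scheme \<Rightarrow> ('k, 'a, 'm) module_scheme \<Rightarrow> ('k, 'b, 'n) module_scheme \<Rightarrow>
      ('k, ('a \<times> 'b \<Rightarrow> 'k) set) module"
  where "tensor_algebra R A B = (tensor R A B)
    \<lparr>mult := (\<lambda>s t. tensor_op R A B (mult A) (mult B) (tens R (tensor R A B) (tensor R A B) s t)),
     one := tens R A B \<one>\<^bsub>A\<^esub> \<one>\<^bsub>B\<^esub>\<rparr>"


section \<open>Algebras, coalgebras, bialgebras\<close>

text \<open>The library's \<open>algebra\<close> is commutative.\<close>

locale unital_algebra = module R A + ring A for R (structure) and A (structure) +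
  assumes smult_mult_left:
      "\<lbrakk>r \<in> carrier R; x \<in> carrier A; y \<in> carrier A\<rbrakk> \<Longrightarrow> (r \<odot>\<^bsub>A\<^esub> x) \<otimes>\<^bsub>A\<^esub> y = r \<odot>\<^bsub>A\<^esub> (x \<otimes>\<^bsub>A\<^esub> y)"
    and smult_mult_right:
      "\<lbrakk>r \<in> carrier R; x \<in> carrier A; y \<in> carrier A\<rbrakk> \<Longrightarrow> x \<otimes>\<^bsub>A\<^esub> (r \<odot>\<^bsub>A\<^esub> y) = r \<odot>\<^bsub>A\<^esub> (x \<otimes>\<^bsub>A\<^esub> y)"

locale coalgebra = module R D for R (structure) and D (structure) +
  fixes \<Delta> :: "'c \<Rightarrow> ('c \<times> 'c \<Rightarrow> 'a) set" and \<epsilon> :: "'c \<Rightarrow> 'a"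
  assumes comult_linear: "linear_map R D (tensor R D D) \<Delta>"
    and counit_linear: "linear_map R D (self_module R) \<epsilon>"
    and coassoc: "x \<in> carrier D \<Longrightarrow>
      tensor_assoc R D D D (tensor_map R (tensor R D D) D \<Delta> id (\<Delta> x)) =
      tensor_map R D (tensor R D D) id \<Delta> (\<Delta> x)"
    \<comment> \<open>\<open>\<epsilon> \<otimes> id\<close> and \<open>id \<otimes> \<epsilon>\<close>, composed with the scalar actions that identify \<open>R \<otimes> D\<close> and \<open>D \<otimes> R\<close> with \<open>D\<close>\<close>
    and counit_left: "x \<in> carrier D \<Longrightarrow>
      tensor_lift R D (\<lambda>r d. r \<odot>\<^bsub>D\<^esub> d) (tensor_map R (self_module R) D \<epsilon> id (\<Delta> x)) = x"
    and counit_right: "x \<in> carrier D \<Longrightarrow>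
      tensor_lift R D (\<lambda>d r. r \<odot>\<^bsub>D\<^esub> d) (tensor_map R D (self_module R) id \<epsilon> (\<Delta> x)) = x"

locale bialgebra = unital_algebra R H + coalgebra R H \<Delta> \<epsilon>
  for R (structure) and H (structure) and \<Delta> and \<epsilon> +
  assumes comult_hom: "\<Delta> \<in> ring_hom H (tensor_algebra R H H)"
    and counit_hom: "\<epsilon> \<in> ring_hom H R"

text \<open>Linear maps \<open>A \<otimes> A \<rightarrow> A\<close> are given as bilinear maps in two arguments.\<close>

locale vee_algebra = unital_algebra R A for R (structure) and A (structure) +
  fixes \<Omega> :: "'w set" and vee :: "'w \<Rightarrow> 'c \<Rightarrow> 'c \<Rightarrow> 'c"
  assumes vee_bilinear: "\<alpha> \<in> \<Omega> \<Longrightarrow> bilinear_map R A A A (vee \<alpha>)"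
    and vee_mult:
      "\<lbrakk>\<alpha> \<in> \<Omega>; \<beta> \<in> \<Omega>; a1 \<in> carrier A; a2 \<in> carrier A; b1 \<in> carrier A; b2 \<in> carrier A;
        a = vee \<alpha> a1 a2; b = vee \<beta> b1 b2\<rbrakk> \<Longrightarrow>
       a \<otimes>\<^bsub>A\<^esub> b = vee \<alpha> a1 (a2 \<otimes>\<^bsub>A\<^esub> b) \<oplus>\<^bsub>A\<^esub> vee \<beta> (a \<otimes>\<^bsub>A\<^esub> b1) b2"

locale cocycle_vee_bialgebra = bialgebra R H \<Delta> \<epsilon> + vee_algebra R H \<Omega> vee
  for R (structure) and H (structure) and \<Delta> and \<epsilon> and \<Omega> and vee +
  assumes cocycle:
    "\<lbrakk>\<alpha> \<in> \<Omega>; h \<in> carrier H; h' \<in> carrier H\<rbrakk> \<Longrightarrow>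
     \<Delta> (vee \<alpha> h h') =
       tens R H H (vee \<alpha> h h') \<one>\<^bsub>H\<^esub> \<oplus>\<^bsub>tensor R H H\<^esub>
       tensor_op R H H (mult H) (vee \<alpha>) (tens R (tensor R H H) (tensor R H H) (\<Delta> h) (\<Delta> h'))"


section \<open>Coideals and biideals\<close>

text \<open>The image in \<open>D \<otimes> D\<close> of \<open>I \<otimes> J\<close>, for submodules \<open>I\<close> and \<open>J\<close> of \<open>D\<close>\<close>

definition tensor_image ::
    "('k, 'r) ring_scheme \<Rightarrow> ('k, 'a, 'm) module_scheme \<Rightarrow> 'a set \<Rightarrow> 'a set \<Rightarrow> ('a \<times> 'a \<Rightarrow> 'k) set set"
  where "tensor_image R D I J =
    tensor_map R D D id id ` carrier (tensor R (D\<lparr>carrier := I\<rparr>) (D\<lparr>carrier := J\<rparr>))"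

definition coideal ::
    "('k, 'r) ring_scheme \<Rightarrow> ('k, 'a, 'm) module_scheme \<Rightarrow> ('a \<Rightarrow> ('a \<times> 'a \<Rightarrow> 'k) set) \<Rightarrow> ('a \<Rightarrow> 'k) \<Rightarrow>
      'a set \<Rightarrow> bool"
  where "coideal R D \<Delta> \<epsilon> I \<longleftrightarrow>
    submodule I R D \<and> I \<subseteq> a_kernel D R \<epsilon> \<and>
    \<Delta> ` I \<subseteq> tensor_image R D I (carrier D) <+>\<^bsub>tensor R D D\<^esub> tensor_image R D (carrier D) I"

definition biideal ::
    "('k, 'r) ring_scheme \<Rightarrow> ('k, 'a, 'm) module_scheme \<Rightarrow> ('a \<Rightarrow> ('a \<times> 'a \<Rightarrow> 'k) set) \<Rightarrow> ('a \<Rightarrow> 'k) \<Rightarrow>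
      'a set \<Rightarrow> bool"
  where "biideal R H \<Delta> \<epsilon> I \<longleftrightarrow> submodule I R H \<and> ideal I H \<and> coideal R H \<Delta> \<epsilon> I"

end

theory Submission
  imports Defs
begin

text \<open>For (b), let I be the ideal of H generated by C and let J be the sum of the images of I
  \<otimes> H and H \<otimes> I in H \<otimes> H. Since I is an ideal, multiplying an element of J
  by any tensor, on either side, stays in J. As \<Delta> is an algebra map, the preimage of J under
  \<Delta> is an ideal of H. It contains C because C is a coideal, so it contains I. Likewise the
  kernel of \<epsilon> is an ideal containing C, hence it contains I. This is
  \<open>genideal_biideal\<close>.

  For (a), let I be the span of the values of \<open>vee \<alpha>\<close>. The cocycle condition
  writes \<Delta>(h \<or> h') as (h \<or> h') \<otimes> 1, which lies in the image of I \<otimes> H,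
  plus a sum of pure tensors whose right factors are values of \<open>vee \<alpha>\<close>, which
  lies in the image of H \<otimes> I. For the counit, put \<phi> = \<epsilon> \<otimes> id, with
  values in H. The composite \<epsilon> \<phi> sends the first summand to \<epsilon>(h \<or> h'),
  and the second to \<epsilon>(\<phi>(\<Delta> h) \<or> \<phi>(\<Delta> h')) = \<epsilon>(h \<or>
  h') by the counit law. Hence \<epsilon>(h \<or> h') is twice itself, so it is zero. These are
  \<open>counit_vee\<close> and \<open>vee_span_coideal\<close>.

  Tensors are cosets of formal sums, so no tensor is ever decomposed by hand. The elements with a
  desired linear property form a submodule, and \<open>tensor_gens\<close> reduces the property to
  pure tensors. Two consequences carry the rest: \<open>linear_map_tensor_eqI\<close> for
  equalities, and \<open>tensor_op_tensor_image\<close> for where products of tensors land.\<close>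

section \<open>Linear and bilinear maps\<close>

lemma linear_mapI:
  assumes "\<And>x. x \<in> carrier M \<Longrightarrow> f x \<in> carrier N"
    and "\<And>x y. \<lbrakk>x \<in> carrier M; y \<in> carrier M\<rbrakk> \<Longrightarrow> f (x \<oplus>\<^bsub>M\<^esub> y) = f x \<oplus>\<^bsub>N\<^esub> f y"
    and "\<And>r x. \<lbrakk>r \<in> carrier R; x \<in> carrier M\<rbrakk> \<Longrightarrow> f (r \<odot>\<^bsub>M\<^esub> x) = r \<odot>\<^bsub>N\<^esub> f x"
  shows "linear_map R M N f"
  using assms by (auto simp: linear_map_def)

lemma linear_mapD:
  assumes "linear_map R M N f"
  shows "x \<in> carrier M \<Longrightarrow> f x \<in> carrier N"
    and "\<lbrakk>x \<in> carrier M; y \<in> carrier M\<rbrakk> \<Longrightarrow> f (x \<oplus>\<^bsub>M\<^esub> y) = f x \<oplus>\<^bsub>N\<^esub> f y"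
    and "\<lbrakk>r \<in> carrier R; x \<in> carrier M\<rbrakk> \<Longrightarrow> f (r \<odot>\<^bsub>M\<^esub> x) = r \<odot>\<^bsub>N\<^esub> f x"
  using assms by (auto simp: linear_map_def)

lemma linear_map_compose:
  assumes "linear_map R M N f" "linear_map R N P g"
  shows "linear_map R M P (\<lambda>x. g (f x))"
  using assms by (intro linear_mapI) (auto simp: linear_mapD)

lemma linear_map_id: "linear_map R M M id"
  by (auto intro: linear_mapI)

lemma linear_map_add:
  assumes "module R N" and f: "linear_map R M N f" and g: "linear_map R M N g"
  shows "linear_map R M N (\<lambda>x. f x \<oplus>\<^bsub>N\<^esub> g x)"
proof -
  interpret N: module R N by fact
  show ?thesis
    by (rule linear_mapI) (auto simp: linear_mapD[OF f] linear_mapD[OF g] N.smult_r_distr N.M.a_ac)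
qed

lemma linear_map_smult:
  assumes "module R N" and f: "linear_map R M N f" and r: "r \<in> carrier R"
  shows "linear_map R M N (\<lambda>x. r \<odot>\<^bsub>N\<^esub> f x)"
proof -
  interpret N: module R N by fact
  show ?thesis
    using r by (intro linear_mapI)
      (auto simp: linear_mapD[OF f] N.smult_r_distr N.smult_assoc1[symmetric] N.R.m_comm)
qed

lemma linear_map_neg:
  assumes "module R M" "module R N" and f: "linear_map R M N f" and x: "x \<in> carrier M"
  shows "f (\<ominus>\<^bsub>M\<^esub> x) = \<ominus>\<^bsub>N\<^esub> f x"
proof -
  interpret M: module R M by fact
  interpret N: module R N by fact
  \<comment> \<open>Negation is the scalar action of -1, which f preserves.\<close>
  have "f (\<ominus>\<^bsub>M\<^esub> x) = (\<ominus>\<^bsub>R\<^esub> \<one>\<^bsub>R\<^esub>) \<odot>\<^bsub>N\<^esub> f x"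
    using x by (simp add: linear_mapD(3)[OF f, symmetric] M.smult_l_minus)
  then show ?thesis using x by (simp add: N.smult_l_minus linear_mapD(1)[OF f])
qed

lemma linear_map_zero:
  assumes "module R M" "module R N" and f: "linear_map R M N f"
  shows "f \<zero>\<^bsub>M\<^esub> = \<zero>\<^bsub>N\<^esub>"
  using linear_ker[OF assms] submodule.axioms(1) subgroup.one_closed by fastforce

text \<open>Turns equality of two linear maps into membership in a submodule, so that it can be
  checked on generators. \<open>linear_map_vimage_submodule\<close> does the same for conditions of
  the form "f x lies in L".\<close>

lemma linear_map_equalizer_submodule:
  assumes "module R M" "module R N" and f: "linear_map R M N f" and g: "linear_map R M N g"
  shows "submodule {x \<in> carrier M. f x = g x} R M"
proof -
  interpret M: module R M by fact
  show ?thesis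
    using assms(1,2) by (intro M.submoduleI)
      (auto simp: linear_mapD[OF f] linear_mapD[OF g] linear_map_neg[OF _ _ f] linear_map_neg[OF _ _ g]
        linear_map_zero[OF _ _ f] linear_map_zero[OF _ _ g])
qed

lemma linear_map_vimage_submodule:
  assumes "module R M" "module R N" and f: "linear_map R M N f" and L: "submodule L R N"
  shows "submodule {x \<in> carrier M. f x \<in> L} R M"
proof -
  interpret M: module R M by fact
  interpret N: module R N by fact
  show ?thesis
    using assms(1,2) N.submoduleE[OF L] subgroup.one_closed[OF submodule.axioms(1)[OF L]]
    by (intro M.submoduleI) (auto simp: linear_mapD[OF f] linear_map_neg[OF _ _ f] linear_map_zero[OF _ _ f])
qed

lemma linear_map_image_submodule:
  assumes "module R M" "module R N" and f: "linear_map R M N f"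
  shows "submodule (f ` carrier M) R N"
proof -
  interpret M: module R M by fact
  interpret N: module R N by fact
  show ?thesis
  proof (rule N.submoduleI)
    show "\<zero>\<^bsub>N\<^esub> \<in> f ` carrier M"
      using linear_map_zero[OF assms] by (intro image_eqI[of _ _ "\<zero>\<^bsub>M\<^esub>"]) auto
  qed (auto simp: linear_mapD(1)[OF f] linear_map_neg[OF assms, symmetric] linear_mapD(2,3)[OF f, symmetric])
qed

lemma bilinear_mapI:
  assumes "\<And>x. x \<in> carrier M \<Longrightarrow> linear_map R N P (f x)"
    and "\<And>y. y \<in> carrier N \<Longrightarrow> linear_map R M P (\<lambda>x. f x y)"
  shows "bilinear_map R M N P f"
  using assms by (simp add: bilinear_map_def)

lemma bilinear_mapD:
  assumes "bilinear_map R M N P f"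
  shows "x \<in> carrier M \<Longrightarrow> linear_map R N P (f x)"
    and "y \<in> carrier N \<Longrightarrow> linear_map R M P (\<lambda>x. f x y)"
  using assms by (simp_all add: bilinear_map_def)

lemma bilinear_map_closed:
  "\<lbrakk>bilinear_map R M N P f; x \<in> carrier M; y \<in> carrier N\<rbrakk> \<Longrightarrow> f x y \<in> carrier P"
  by (blast dest: bilinear_mapD linear_mapD(1))

lemma bilinear_map_compose:
  assumes "linear_map R M M' f" "linear_map R N N' g" "bilinear_map R M' N' P B" "linear_map R P Q h"
  shows "bilinear_map R M N Q (\<lambda>x y. h (B (f x) (g y)))"
proof (rule bilinear_mapI)
  fix x assume "x \<in> carrier M"
  then have "linear_map R N' P (B (f x))"
    by (intro bilinear_mapD(1)[OF assms(3)] linear_mapD(1)[OF assms(1)])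
  from linear_map_compose[OF linear_map_compose[OF assms(2) this] assms(4)]
  show "linear_map R N Q (\<lambda>y. h (B (f x) (g y)))" .
next
  fix y assume "y \<in> carrier N"
  then have "linear_map R M' P (\<lambda>x. B x (g y))"
    by (intro bilinear_mapD(2)[OF assms(3)] linear_mapD(1)[OF assms(2)])
  from linear_map_compose[OF linear_map_compose[OF assms(1) this] assms(4)]
  show "linear_map R M Q (\<lambda>x. h (B (f x) (g y)))" .
qed

lemma self_module_module: "cring R \<Longrightarrow> module R (self_module R)"
proof -
  assume "cring R"
  then interpret cring R .
  show ?thesis
  proof (rule moduleI)
    show "abelian_group (self_module R)"
      by (rule abelian_groupI) (auto simp: self_module_def a_ac intro: l_neg)
  qed (auto simp: self_module_def l_distr r_distr m_assoc is_cring)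
qed

section \<open>Pure tensors as generators of a tensor product\<close>

section \<open>Pure tensors\<close>

text \<open>Induction on a finite set containing the support: each step splits off one multiple of a
  generator.\<close>

lemma free_module_gens:
  assumes "cring R" and L: "submodule L R (free_module R A)" and gens: "\<And>a. a \<in> A \<Longrightarrow> free_gen R a \<in> L"
    and u: "u \<in> carrier (free_module R A)"
  shows "u \<in> L"
proof -
  interpret cring R by fact
  interpret F: module R "free_module R A" by (rule free_module_module) fact
  have "\<forall>u. u \<in> carrier (free_module R A) \<longrightarrow> {a. u a \<noteq> \<zero>\<^bsub>R\<^esub>} \<subseteq> S \<longrightarrow> u \<in> L" if "finite S" for S
    using that
  proof (induction S rule: finite_induct)
    case empty
    have "u = \<zero>\<^bsub>free_module R A\<^esub>" if "{a. u a \<noteq> \<zero>\<^bsub>R\<^esub>} \<subseteq> {}" for u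
      using that by (auto simp: free_module_simps)
    then show ?case using subgroup.one_closed[OF submodule.axioms(1)[OF L]] by auto
  next
    case (insert s S)
    show ?case
    proof (intro allI impI)
      fix u assume u: "u \<in> carrier (free_module R A)" and sub: "{a. u a \<noteq> \<zero>\<^bsub>R\<^esub>} \<subseteq> insert s S"
      show "u \<in> L"
      proof (cases "s \<in> A")
        case False
        then have "u s = \<zero>\<^bsub>R\<^esub>" using u by (auto simp: free_module_simps)
        then show ?thesis using insert.IH u sub by blast
      next
        case True
        \<comment> \<open>v is u with its coefficient at s erased, so its support lies in S and the
          induction hypothesis applies to it.\<close>
        define v where "v = (\<lambda>a. if a = s then \<zero>\<^bsub>R\<^esub> else u a)"
        have v: "v \<in> carrier (free_module R A)" "{a. v a \<noteq> \<zero>\<^bsub>R\<^esub>} \<subseteq> S"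
          using u sub by (auto simp: v_def free_module_simps elim: rev_finite_subset)
        have c: "u a \<in> carrier R" for a using u by (auto simp: free_module_simps)
        have "u = v \<oplus>\<^bsub>free_module R A\<^esub> (u s \<odot>\<^bsub>free_module R A\<^esub> free_gen R s)"
          using c by (auto simp: v_def free_module_simps free_gen_def fun_eq_iff)
        moreover have "v \<in> L" using insert.IH v by blast
        ultimately show ?thesis using F.submoduleE(4,5)[OF L] gens[OF True] c by metis
      qed
    qed
  qed
  from this[of "{a. u a \<noteq> \<zero>\<^bsub>R\<^esub>}"] u show ?thesis by (simp add: free_module_simps)
qed

text \<open>Every tensor is the coset of a formal sum. The preimage of L under the quotient map is a
  submodule of the free module that contains all its generators, hence it is everything. This is the
  induction principle for tensors used from here on.\<close>

lemma tensor_gens: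
  assumes "module R M" "module R N" and L: "submodule L R (tensor R M N)"
    and gens: "\<And>x y. \<lbrakk>x \<in> carrier M; y \<in> carrier N\<rbrakk> \<Longrightarrow> tens R M N x y \<in> L"
    and t: "t \<in> carrier (tensor R M N)"
  shows "t \<in> L"
proof -
  interpret M: module R M by fact
  define F where "F = free_module R (carrier M \<times> carrier N)"
  interpret F: module R F unfolding F_def by (rule free_module_module) (rule M.R.is_cring)
  let ?\<pi> = "\<lambda>u. tensor_null R M N +>\<^bsub>F\<^esub> u"
  have "submodule (tensor_null R M N) R F"
    unfolding tensor_null_def F_def[symmetric]
    using span_submodule(1)[OF F.module_axioms] tensor_rels_closed[OF assms(1,2)] by (auto simp: F_def)
  from quot_module_module(2)[OF F.module_axioms this]
  have lin: "linear_map R F (tensor R M N) ?\<pi>" by (simp add: tensor_def F_def)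
  obtain u where u: "u \<in> carrier F" "t = ?\<pi> u"
    using t by (auto simp: tensor_def F_def quot_module_def A_RCOSETS_def')
  have "u \<in> {u \<in> carrier F. ?\<pi> u \<in> L}"
  proof (rule free_module_gens[OF M.R.is_cring])
    show "submodule {u \<in> carrier F. ?\<pi> u \<in> L} R (free_module R (carrier M \<times> carrier N))"
      using linear_map_vimage_submodule[OF F.module_axioms tensor_module[OF assms(1,2)] lin L]
      by (simp add: F_def)
  next
    fix a assume "a \<in> carrier M \<times> carrier N"
    then show "free_gen R a \<in> {u \<in> carrier F. ?\<pi> u \<in> L}"
      using gens free_gen_closed[OF M.R.is_cring, of a "carrier M \<times> carrier N"] by (auto simp: F_def tens_def)
  qed (use u in \<open>simp add: F_def\<close>)
  then show ?thesis using u by simp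
qed

lemma tens_closed:
  "\<lbrakk>module R M; module R N; x \<in> carrier M; y \<in> carrier N\<rbrakk> \<Longrightarrow> tens R M N x y \<in> carrier (tensor R M N)"
  by (rule bilinear_map_closed[OF tens_bilinear])

lemma linear_map_tensor_eqI:
  assumes "module R M" "module R N" "module R P"
    and "linear_map R (tensor R M N) P f" "linear_map R (tensor R M N) P g"
    and "\<And>x y. \<lbrakk>x \<in> carrier M; y \<in> carrier N\<rbrakk> \<Longrightarrow> f (tens R M N x y) = g (tens R M N x y)"
    and "t \<in> carrier (tensor R M N)"
  shows "f t = g t"
  using tensor_gens[OF assms(1,2) linear_map_equalizer_submodule[OF tensor_module[OF assms(1,2)] assms(3-5)] _ assms(7)]
    assms(6) tens_closed[OF assms(1,2)] by auto

text \<open>The linear version is applied twice: with t fixed it reduces s to a pure tensor, and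
  with that tensor fixed it reduces t.\<close>

lemma bilinear_map_tensor_eqI:
  assumes m: "module R M" "module R N" "module R P" "module R Q" "module R L"
    and f: "bilinear_map R (tensor R M N) (tensor R P Q) L f"
    and g: "bilinear_map R (tensor R M N) (tensor R P Q) L g"
    and eq: "\<And>x y z w. \<lbrakk>x \<in> carrier M; y \<in> carrier N; z \<in> carrier P; w \<in> carrier Q\<rbrakk> \<Longrightarrow>
      f (tens R M N x y) (tens R P Q z w) = g (tens R M N x y) (tens R P Q z w)"
    and s: "s \<in> carrier (tensor R M N)" and t: "t \<in> carrier (tensor R P Q)"
  shows "f s t = g s t"
proof (rule linear_map_tensor_eqI[OF m(1,2,5) bilinear_mapD(2)[OF f t] bilinear_mapD(2)[OF g t] _ s])
  fix x y assume xy: "x \<in> carrier M" "y \<in> carrier N"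
  note c = tens_closed[OF m(1,2) this]
  show "f (tens R M N x y) t = g (tens R M N x y) t"
    by (rule linear_map_tensor_eqI[OF m(3,4,5) bilinear_mapD(1)[OF f c] bilinear_mapD(1)[OF g c] _ t])
      (use eq xy in auto)
qed

text \<open>Needed because \<open>tau23\<close> nests one lift inside another: the outer lift makes
  sense only if the inner one depends linearly on the outer arguments. For each law, both sides are
  linear in t and agree on pure tensors.\<close>

lemma tensor_lift_linear_param:
  assumes m: "module R K" "module R M" "module R N" "module R P"
    and bil: "\<And>p. p \<in> carrier K \<Longrightarrow> bilinear_map R M N P (F p)"
    and lin: "\<And>x y. \<lbrakk>x \<in> carrier M; y \<in> carrier N\<rbrakk> \<Longrightarrow> linear_map R K P (\<lambda>p. F p x y)"
    and t: "t \<in> carrier (tensor R M N)"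
  shows "linear_map R K P (\<lambda>p. tensor_lift R P (F p) t)"
proof -
  interpret K: module R K by fact
  note lift = tensor_lift_universal(1)[OF m(2-4) bil]
  note ev = tensor_lift_universal(2)[OF m(2-4) bil]
  show ?thesis
  proof (rule linear_mapI)
    fix p assume "p \<in> carrier K"
    then show "tensor_lift R P (F p) t \<in> carrier P" using lift t by (auto dest: linear_mapD(1))
  next
    fix p q assume pq: "p \<in> carrier K" "q \<in> carrier K"
    then have s: "p \<oplus>\<^bsub>K\<^esub> q \<in> carrier K" by simp
    show "tensor_lift R P (F (p \<oplus>\<^bsub>K\<^esub> q)) t = tensor_lift R P (F p) t \<oplus>\<^bsub>P\<^esub> tensor_lift R P (F q) t"
      by (rule linear_map_tensor_eqI[OF m(2-4) lift[OF s] linear_map_add[OF m(4) lift lift] _ t])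
        (use pq s in \<open>auto simp: ev linear_mapD(2)[OF lin]\<close>)
  next
    fix r p assume rp: "r \<in> carrier R" "p \<in> carrier K"
    then have s: "r \<odot>\<^bsub>K\<^esub> p \<in> carrier K" by simp
    show "tensor_lift R P (F (r \<odot>\<^bsub>K\<^esub> p)) t = r \<odot>\<^bsub>P\<^esub> tensor_lift R P (F p) t"
      by (rule linear_map_tensor_eqI[OF m(2-4) lift[OF s] linear_map_smult[OF m(4) lift] _ t])
        (use rp s in \<open>auto simp: ev linear_mapD(3)[OF lin]\<close>)
  qed
qed

section \<open>Canonical maps on tensor products and their values on pure tensors\<close>

lemma tensor_map_props:
  assumes m: "module R M" "module R N" "module R M'" "module R N'"
    and f: "linear_map R M M' f" and g: "linear_map R N N' g"
  shows tensor_map_linear: "linear_map R (tensor R M N) (tensor R M' N') (tensor_map R M' N' f g)"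
    and tensor_map_tens: "\<lbrakk>x \<in> carrier M; y \<in> carrier N\<rbrakk> \<Longrightarrow>
      tensor_map R M' N' f g (tens R M N x y) = tens R M' N' (f x) (g y)"
proof -
  have "bilinear_map R M N (tensor R M' N') (\<lambda>x y. tens R M' N' (f x) (g y))"
    using bilinear_map_compose[OF f g tens_bilinear[OF m(3,4)] linear_map_id] by simp
  from tensor_lift_universal[OF m(1,2) tensor_module[OF m(3,4)] this]
  show "linear_map R (tensor R M N) (tensor R M' N') (tensor_map R M' N' f g)"
    "\<lbrakk>x \<in> carrier M; y \<in> carrier N\<rbrakk> \<Longrightarrow>
      tensor_map R M' N' f g (tens R M N x y) = tens R M' N' (f x) (g y)"
    by (simp_all add: tensor_map_def)
qed

lemma tau23_props:
  assumes m: "module R M" "module R N" "module R P" "module R Q"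
  shows tau23_linear: "linear_map R (tensor R (tensor R M N) (tensor R P Q))
      (tensor R (tensor R M P) (tensor R N Q)) (tau23 R M N P Q)"
    and tau23_tens: "\<lbrakk>x \<in> carrier M; y \<in> carrier N; z \<in> carrier P; w \<in> carrier Q\<rbrakk> \<Longrightarrow>
      tau23 R M N P Q (tens R (tensor R M N) (tensor R P Q) (tens R M N x y) (tens R P Q z w)) =
      tens R (tensor R M P) (tensor R N Q) (tens R M P x z) (tens R N Q y w)"
proof -
  define MP NQ T where "MP = tensor R M P" and "NQ = tensor R N Q" and "T = tensor R MP NQ"
  have mod: "module R MP" "module R NQ" "module R T" "module R (tensor R M N)" "module R (tensor R P Q)"
    by (simp_all add: MP_def NQ_def T_def tensor_module m)
  note bT = tens_bilinear[OF mod(1,2), folded T_def]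
  note bMP = tens_bilinear[OF m(1,3), folded MP_def]
  note bNQ = tens_bilinear[OF m(2,4), folded NQ_def]
  \<comment> \<open>The functions f, g, h are the layers of the nested lifts in
    \<open>tau23\<close>, from the inside out. Each is shown bilinear or linear in the arguments
    that the next lift consumes.\<close>
  define f where "f x y z w = tens R MP NQ (tens R M P x z) (tens R N Q y w)" for x y z w
  define g where "g x y = tensor_lift R T (f x y)" for x y
  define h where "h s t = tensor_lift R T (\<lambda>x y. g x y t) s" for s t
  have f: "bilinear_map R P Q T (f x y)" if "x \<in> carrier M" "y \<in> carrier N" for x y
    using bilinear_map_compose[OF bilinear_mapD(1)[OF bMP that(1)] bilinear_mapD(1)[OF bNQ that(2)] bT linear_map_id]
    by (simp add: f_def[abs_def])
  have f': "bilinear_map R M N T (\<lambda>x y. f x y z w)" if "z \<in> carrier P" "w \<in> carrier Q" for z w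
    using bilinear_map_compose[OF bilinear_mapD(2)[OF bMP that(1)] bilinear_mapD(2)[OF bNQ that(2)] bT linear_map_id]
    by (simp add: f_def)
  have g: "linear_map R (tensor R P Q) T (g x y)" if "x \<in> carrier M" "y \<in> carrier N" for x y
    unfolding g_def by (rule tensor_lift_universal(1)[OF m(3,4) mod(3) f[OF that]])
  have g': "bilinear_map R M N T (\<lambda>x y. g x y t)" if "t \<in> carrier (tensor R P Q)" for t
    unfolding g_def
    by (intro bilinear_mapI tensor_lift_linear_param[OF _ m(3,4) mod(3) _ _ that] f m)
      (auto intro: bilinear_mapD[OF f'])
  have h: "bilinear_map R (tensor R M N) (tensor R P Q) T h"
  proof (rule bilinear_mapI)
    fix s assume "s \<in> carrier (tensor R M N)"
    then show "linear_map R (tensor R P Q) T (h s)"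
      unfolding h_def[abs_def]
      by (intro tensor_lift_linear_param[OF mod(5) m(1,2) mod(3)] g' g)
  next
    fix t assume "t \<in> carrier (tensor R P Q)"
    then show "linear_map R (tensor R M N) T (\<lambda>s. h s t)"
      unfolding h_def by (intro tensor_lift_universal(1)[OF m(1,2) mod(3)] g')
  qed
  have tau: "tau23 R M N P Q = tensor_lift R T h"
    by (simp add: tau23_def Let_def MP_def NQ_def T_def h_def[abs_def] g_def[abs_def] f_def[abs_def])
  show "linear_map R (tensor R (tensor R M N) (tensor R P Q))
      (tensor R (tensor R M P) (tensor R N Q)) (tau23 R M N P Q)"
    using tensor_lift_universal(1)[OF mod(4,5,3) h] by (simp add: tau MP_def NQ_def T_def)
  assume xyzw: "x \<in> carrier M" "y \<in> carrier N" "z \<in> carrier P" "w \<in> carrier Q"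
  then have c: "tens R M N x y \<in> carrier (tensor R M N)" "tens R P Q z w \<in> carrier (tensor R P Q)"
    by (simp_all add: tens_closed m)
  have "h (tens R M N x y) (tens R P Q z w) = g x y (tens R P Q z w)"
    unfolding h_def by (rule tensor_lift_universal(2)[OF m(1,2) mod(3) g'[OF c(2)] xyzw(1,2)])
  also have "\<dots> = f x y z w"
    unfolding g_def by (rule tensor_lift_universal(2)[OF m(3,4) mod(3) f[OF xyzw(1,2)] xyzw(3,4)])
  finally show "tau23 R M N P Q (tens R (tensor R M N) (tensor R P Q) (tens R M N x y) (tens R P Q z w)) =
      tens R (tensor R M P) (tensor R N Q) (tens R M P x z) (tens R N Q y w)"
    using tensor_lift_universal(2)[OF mod(4,5,3) h c] by (simp add: tau f_def MP_def NQ_def)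
qed

lemma tensor_op_props:
  assumes m: "module R M" "module R N"
    and f: "bilinear_map R M M M f" and g: "bilinear_map R N N N g"
  shows tensor_op_bilinear: "bilinear_map R (tensor R M N) (tensor R M N) (tensor R M N)
      (\<lambda>s t. tensor_op R M N f g (tens R (tensor R M N) (tensor R M N) s t))"
    and tensor_op_tens: "\<lbrakk>x \<in> carrier M; y \<in> carrier N; z \<in> carrier M; w \<in> carrier N\<rbrakk> \<Longrightarrow>
      tensor_op R M N f g (tens R (tensor R M N) (tensor R M N) (tens R M N x y) (tens R M N z w)) =
      tens R M N (f x z) (g y w)"
proof -
  note mod = tensor_module[OF m] tensor_module[OF m(1,1)] tensor_module[OF m(2,2)]
  note F = tensor_lift_universal[OF m(1,1,1) f] and G = tensor_lift_universal[OF m(2,2,2) g]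
  note FG = tensor_map_props[OF mod(2,3) m F(1) G(1)]
  have "linear_map R (tensor R (tensor R M N) (tensor R M N)) (tensor R M N) (tensor_op R M N f g)"
    using linear_map_compose[OF tau23_linear[OF m m] FG(1)] by (simp add: tensor_op_def comp_def)
  from bilinear_map_compose[OF linear_map_id linear_map_id tens_bilinear[OF mod(1,1)] this]
  show "bilinear_map R (tensor R M N) (tensor R M N) (tensor R M N)
      (\<lambda>s t. tensor_op R M N f g (tens R (tensor R M N) (tensor R M N) s t))" by simp
  assume "x \<in> carrier M" "y \<in> carrier N" "z \<in> carrier M" "w \<in> carrier N"
  then show "tensor_op R M N f g (tens R (tensor R M N) (tensor R M N) (tens R M N x y) (tens R M N z w)) =
      tens R M N (f x z) (g y w)"
    by (simp add: tensor_op_def tau23_tens m FG(2) tens_closed F(2) G(2))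
qed

section \<open>Images in the tensor square of tensor products of submodules\<close>

section \<open>Submodules of a tensor square\<close>

text \<open>The defining map is induced by the inclusions of I and J, which need not be injective on
  tensors over a general ring. These three facts characterize its image as the span of the pure
  tensors from I and J, and replace the definition in most later arguments.\<close>

lemma tensor_image_props:
  assumes D: "module R D" and I: "submodule I R D" and J: "submodule J R D"
  shows tensor_image_submodule: "submodule (tensor_image R D I J) R (tensor R D D)"
    and tens_in_tensor_image: "\<lbrakk>x \<in> I; y \<in> J\<rbrakk> \<Longrightarrow> tens R D D x y \<in> tensor_image R D I J"
    and tensor_image_minimal: "\<lbrakk>submodule L R (tensor R D D); \<And>x y. \<lbrakk>x \<in> I; y \<in> J\<rbrakk> \<Longrightarrow> tens R D D x y \<in> L\<rbrakk>
      \<Longrightarrow> tensor_image R D I J \<subseteq> L"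
proof -
  let ?I = "D\<lparr>carrier := I\<rparr>" and ?J = "D\<lparr>carrier := J\<rparr>"
  interpret D: module R D by fact
  have m: "module R ?I" "module R ?J"
    using submodule.submodule_is_module[OF _ D] I J by blast+
  note T = tensor_module[OF m] and TD = tensor_module[OF D D]
  have l: "linear_map R ?I D id" "linear_map R ?J D id"
    using D.submoduleE(1)[OF I] D.submoduleE(1)[OF J] by (auto simp: linear_map_def)
  note map = tensor_map_props[OF m D D l]
  show "submodule (tensor_image R D I J) R (tensor R D D)"
    unfolding tensor_image_def by (rule linear_map_image_submodule[OF T TD map(1)])
  show "tens R D D x y \<in> tensor_image R D I J" if "x \<in> I" "y \<in> J"
    unfolding tensor_image_def using that map(2)[of x y] tens_closed[OF m, of x y]
    by (intro image_eqI[of _ _ "tens R ?I ?J x y"]) auto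
  show "tensor_image R D I J \<subseteq> L"
    if L: "submodule L R (tensor R D D)" "\<And>x y. \<lbrakk>x \<in> I; y \<in> J\<rbrakk> \<Longrightarrow> tens R D D x y \<in> L"
  proof -
    have "t \<in> {t \<in> carrier (tensor R ?I ?J). tensor_map R D D id id t \<in> L}"
      if "t \<in> carrier (tensor R ?I ?J)" for t
      by (rule tensor_gens[OF m linear_map_vimage_submodule[OF T TD map(1) L(1)] _ that])
        (use L(2) map(2) tens_closed[OF m] in auto)
    then show ?thesis by (auto simp: tensor_image_def)
  qed
qed

lemma tensor_image_carrier:
  assumes "module R D"
  shows "tensor_image R D (carrier D) (carrier D) = carrier (tensor R D D)"
proof -
  interpret module R D by fact
  interpret T: module R "tensor R D D" by (rule tensor_module[OF assms assms])
  note p = tensor_image_props[OF assms carrier_is_submodule carrier_is_submodule]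
  show ?thesis
    using T.submoduleE(1)[OF p(1)] tensor_gens[OF assms assms p(1) p(2)] by blast
qed

lemma tensor_image_mono:
  assumes "module R D" "submodule I R D" "submodule J R D" "submodule I' R D" "submodule J' R D"
    and "I \<subseteq> I'" "J \<subseteq> J'"
  shows "tensor_image R D I J \<subseteq> tensor_image R D I' J'"
  using assms tensor_image_props(1,2)[OF assms(1,4,5)] by (intro tensor_image_minimal) auto

text \<open>On pure tensors the operation acts factor by factor, so the hypotheses on f and g settle
  that case. Fixing one argument at a time, the good values of the other form a submodule, and
  \<open>tensor_image_minimal\<close> extends the result to all of both images. The ideal property
  in (b) and the cocycle term in (a) are instances.\<close>

lemma tensor_op_tensor_image:
  assumes D: "module R D" and f: "bilinear_map R D D D f" and g: "bilinear_map R D D D g"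
    and sub: "submodule I R D" "submodule J R D" "submodule I' R D" "submodule J' R D"
      "submodule I'' R D" "submodule J'' R D"
    and fI: "\<And>x z. \<lbrakk>x \<in> I; z \<in> I'\<rbrakk> \<Longrightarrow> f x z \<in> I''" and gJ: "\<And>y w. \<lbrakk>y \<in> J; w \<in> J'\<rbrakk> \<Longrightarrow> g y w \<in> J''"
    and s: "s \<in> tensor_image R D I J" and t: "t \<in> tensor_image R D I' J'"
  shows "tensor_op R D D f g (tens R (tensor R D D) (tensor R D D) s t) \<in> tensor_image R D I'' J''"
proof -
  interpret D: module R D by fact
  note T = tensor_module[OF D D]
  interpret T: module R "tensor R D D" by (rule T)
  let ?op = "\<lambda>s t. tensor_op R D D f g (tens R (tensor R D D) (tensor R D D) s t)"
  let ?L = "tensor_image R D I'' J''"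
  note bil = tensor_op_bilinear[OF D D f g]
  note L = tensor_image_submodule[OF D sub(5,6)]
  have tc: "t \<in> carrier (tensor R D D)"
    using T.submoduleE(1)[OF tensor_image_submodule[OF D sub(3,4)]] t by blast
  have c: "x \<in> carrier D" if "x \<in> I \<or> x \<in> J \<or> x \<in> I' \<or> x \<in> J'" for x
    using that sub D.submoduleE(1) by blast
  have "tensor_image R D I J \<subseteq> {s \<in> carrier (tensor R D D). ?op s t \<in> ?L}"
  proof (rule tensor_image_minimal[OF D sub(1,2) linear_map_vimage_submodule[OF T T bilinear_mapD(2)[OF bil tc] L]])
    fix x y assume xy: "x \<in> I" "y \<in> J"
    have s: "tens R D D x y \<in> carrier (tensor R D D)" using xy by (simp add: tens_closed D c)
    have "tensor_image R D I' J' \<subseteq> {t \<in> carrier (tensor R D D). ?op (tens R D D x y) t \<in> ?L}"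
      by (rule tensor_image_minimal[OF D sub(3,4) linear_map_vimage_submodule[OF T T bilinear_mapD(1)[OF bil s] L]])
        (use xy in \<open>auto simp: tens_closed D c tensor_op_tens[OF D D f g] fI gJ tens_in_tensor_image[OF D sub(5,6)]\<close>)
    then show "tens R D D x y \<in> {s \<in> carrier (tensor R D D). ?op s t \<in> ?L}" using t s by blast
  qed
  then show ?thesis using s by blast
qed

section \<open>Sums of two submodules\<close>

lemma submodule_set_add:
  assumes "module R M" and A: "submodule A R M" and B: "submodule B R M"
  shows "submodule (A <+>\<^bsub>M\<^esub> B) R M"
proof -
  interpret module R M by fact
  note a = submoduleE[OF A] subgroup.one_closed[OF submodule.axioms(1)[OF A]]
  note b = submoduleE[OF B] subgroup.one_closed[OF submodule.axioms(1)[OF B]]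
  have mem: "x \<in> A <+>\<^bsub>M\<^esub> B \<longleftrightarrow> (\<exists>a\<in>A. \<exists>b\<in>B. x = a \<oplus>\<^bsub>M\<^esub> b)" for x
    by (auto simp: set_add_def')
  show ?thesis
  proof (rule submoduleI)
    show "A <+>\<^bsub>M\<^esub> B \<subseteq> carrier M" using a(1) b(1) by (auto simp: mem subset_iff)
    show "\<zero>\<^bsub>M\<^esub> \<in> A <+>\<^bsub>M\<^esub> B" using a(7) b(7) by (force simp: mem)
  next
    fix x assume "x \<in> A <+>\<^bsub>M\<^esub> B"
    then obtain p q where "p \<in> A" "q \<in> B" "x = p \<oplus>\<^bsub>M\<^esub> q" by (auto simp: mem)
    moreover from this have "\<ominus>\<^bsub>M\<^esub> x = \<ominus>\<^bsub>M\<^esub> p \<oplus>\<^bsub>M\<^esub> \<ominus>\<^bsub>M\<^esub> q"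
      using a(1) b(1) by (auto intro: M.minus_add)
    ultimately show "\<ominus>\<^bsub>M\<^esub> x \<in> A <+>\<^bsub>M\<^esub> B" using a(3) b(3) by (auto simp: mem)
  next
    fix x y assume "x \<in> A <+>\<^bsub>M\<^esub> B" "y \<in> A <+>\<^bsub>M\<^esub> B"
    then obtain p q p' q' where pq: "p \<in> A" "q \<in> B" "x = p \<oplus>\<^bsub>M\<^esub> q" "p' \<in> A" "q' \<in> B" "y = p' \<oplus>\<^bsub>M\<^esub> q'"
      by (auto simp: mem)
    moreover have "p \<in> carrier M" "q \<in> carrier M" "p' \<in> carrier M" "q' \<in> carrier M"
      using pq a(1) b(1) by auto
    then have "x \<oplus>\<^bsub>M\<^esub> y = (p \<oplus>\<^bsub>M\<^esub> p') \<oplus>\<^bsub>M\<^esub> (q \<oplus>\<^bsub>M\<^esub> q')"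
      using pq by (simp add: M.a_ac)
    ultimately show "x \<oplus>\<^bsub>M\<^esub> y \<in> A <+>\<^bsub>M\<^esub> B" using a(5) b(5) unfolding mem by blast
  next
    fix r x assume r: "r \<in> carrier R" and "x \<in> A <+>\<^bsub>M\<^esub> B"
    then obtain p q where pq: "p \<in> A" "q \<in> B" "x = p \<oplus>\<^bsub>M\<^esub> q" by (auto simp: mem)
    then have "r \<odot>\<^bsub>M\<^esub> x = r \<odot>\<^bsub>M\<^esub> p \<oplus>\<^bsub>M\<^esub> r \<odot>\<^bsub>M\<^esub> q"
      using r a(1) b(1) by (auto intro: smult_r_distr)
    then show "r \<odot>\<^bsub>M\<^esub> x \<in> A <+>\<^bsub>M\<^esub> B" using pq r a(4) b(4) unfolding mem by blast
  qed
qed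

lemma submodule_subset_set_add:
  assumes "module R M" and A: "submodule A R M" and B: "submodule B R M"
  shows "A \<subseteq> A <+>\<^bsub>M\<^esub> B" "B \<subseteq> A <+>\<^bsub>M\<^esub> B"
proof -
  interpret module R M by fact
  have z: "\<zero>\<^bsub>M\<^esub> \<in> A" "\<zero>\<^bsub>M\<^esub> \<in> B" using submodule.axioms(1)[OF A] submodule.axioms(1)[OF B] by (auto dest: subgroup.one_closed)
  have c: "A \<subseteq> carrier M" "B \<subseteq> carrier M" using A B submoduleE(1) by blast+
  show "A \<subseteq> A <+>\<^bsub>M\<^esub> B"
  proof
    fix x assume "x \<in> A"
    with c z have "x = x \<oplus>\<^bsub>M\<^esub> \<zero>\<^bsub>M\<^esub>" by auto
    with \<open>x \<in> A\<close> z show "x \<in> A <+>\<^bsub>M\<^esub> B" unfolding set_add_def' by blast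
  qed
  show "B \<subseteq> A <+>\<^bsub>M\<^esub> B"
  proof
    fix x assume "x \<in> B"
    with c z have "x = \<zero>\<^bsub>M\<^esub> \<oplus>\<^bsub>M\<^esub> x" by auto
    with \<open>x \<in> B\<close> z show "x \<in> A <+>\<^bsub>M\<^esub> B" unfolding set_add_def' by blast
  qed
qed

lemma set_addI: "\<lbrakk>a \<in> A; b \<in> B\<rbrakk> \<Longrightarrow> a \<oplus>\<^bsub>M\<^esub> b \<in> A <+>\<^bsub>M\<^esub> B"
  unfolding set_add_def' by blast

lemma set_add_mono: "\<lbrakk>A \<subseteq> A'; B \<subseteq> B'\<rbrakk> \<Longrightarrow> A <+>\<^bsub>M\<^esub> B \<subseteq> A' <+>\<^bsub>M\<^esub> B'"
  unfolding set_add_def' by blast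

section \<open>Statement (b): the ideal generated by a coideal\<close>

section \<open>Coideals of a bialgebra\<close>

lemma (in unital_algebra) mult_bilinear: "bilinear_map R A A A (mult A)"
  by (intro bilinear_mapI linear_mapI)
    (auto simp: l_distr r_distr smult_mult_left smult_mult_right)

lemma (in unital_algebra) ideal_submodule:
  assumes "ideal I A"
  shows "submodule I R A"
proof -
  interpret I: ideal I A by fact
  show ?thesis
  proof (rule submoduleI)
    fix r x assume r: "r \<in> carrier R" and x: "x \<in> I"
    \<comment> \<open>Scalar multiplication by r is multiplication by the element r 1, so an ideal
      absorbs it.\<close>
    have "r \<odot>\<^bsub>A\<^esub> x = (r \<odot>\<^bsub>A\<^esub> \<one>\<^bsub>A\<^esub>) \<otimes>\<^bsub>A\<^esub> x" using r x by (simp add: smult_mult_left I.Icarr)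
    then show "r \<odot>\<^bsub>A\<^esub> x \<in> I" using I.I_l_closed[OF x] r by simp
  qed (auto simp: I.Icarr I.a_closed)
qed

context bialgebra
begin

lemma tensor_square_module: "module R (tensor R H H)"
  by (rule tensor_module[OF module_axioms module_axioms])

lemma comult_mult:
  assumes "x \<in> carrier H" "y \<in> carrier H"
  shows "\<Delta> (x \<otimes>\<^bsub>H\<^esub> y) =
    tensor_op R H H (mult H) (mult H) (tens R (tensor R H H) (tensor R H H) (\<Delta> x) (\<Delta> y))"
  using ring_hom_mult[OF comult_hom assms] by (simp add: tensor_algebra_def)

text \<open>With \<open>mult_tensor_image_right\<close>, this makes the image of I \<otimes> J
  absorb products from both sides. The whole tensor square enters as the image for I = J = H, by
  \<open>tensor_image_carrier\<close>.\<close>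

lemma mult_tensor_image_left:
  assumes "ideal I H" "ideal J H" "s \<in> carrier (tensor R H H)" "t \<in> tensor_image R H I J"
  shows "tensor_op R H H (mult H) (mult H) (tens R (tensor R H H) (tensor R H H) s t) \<in> tensor_image R H I J"
  using assms ideal_submodule carrier_is_submodule
  by (intro tensor_op_tensor_image[where I="carrier H" and J="carrier H" and I'=I and J'=J])
    (auto simp: module_axioms mult_bilinear tensor_image_carrier[OF module_axioms] ideal.I_l_closed)

lemma mult_tensor_image_right:
  assumes "ideal I H" "ideal J H" "s \<in> tensor_image R H I J" "t \<in> carrier (tensor R H H)"
  shows "tensor_op R H H (mult H) (mult H) (tens R (tensor R H H) (tensor R H H) s t) \<in> tensor_image R H I J"
  using assms ideal_submodule carrier_is_submodule
  by (intro tensor_op_tensor_image[where I'="carrier H" and J'="carrier H" and I=I and J=J])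
    (auto simp: module_axioms mult_bilinear tensor_image_carrier[OF module_axioms] ideal.I_r_closed)

lemma genideal_biideal:
  assumes C: "coideal R H \<Delta> \<epsilon> C"
  shows "biideal R H \<Delta> \<epsilon> (Idl\<^bsub>H\<^esub> C)"
proof -
  interpret \<epsilon>: ring_hom_ring H R \<epsilon>
    by (rule ring_hom_ringI2[OF ring_axioms R.ring_axioms counit_hom])
  let ?I = "Idl\<^bsub>H\<^esub> C" and ?T = "tensor R H H"
  let ?J = "tensor_image R H ?I (carrier H) <+>\<^bsub>?T\<^esub> tensor_image R H (carrier H) ?I"
  let ?op = "\<lambda>s t. tensor_op R H H (mult H) (mult H) (tens R ?T ?T s t)"
  interpret T: module R ?T by (rule tensor_square_module)
  have Csub: "submodule C R H" and Cker: "C \<subseteq> a_kernel H R \<epsilon>"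
    and C\<Delta>: "\<Delta> ` C \<subseteq> tensor_image R H C (carrier H) <+>\<^bsub>?T\<^esub> tensor_image R H (carrier H) C"
    using C by (auto simp: coideal_def)
  have Cc: "C \<subseteq> carrier H" by (rule submoduleE(1)[OF Csub])
  note Iid = genideal_ideal[OF Cc] and CI = genideal_self[OF Cc]
  note Isub = ideal_submodule[OF Iid] and Hsub = carrier_is_submodule
  note img = tensor_image_submodule[OF module_axioms Isub Hsub] tensor_image_submodule[OF module_axioms Hsub Isub]
  note Jsub = submodule_set_add[OF T.module_axioms img]
  have op_add: "?op (s \<oplus>\<^bsub>?T\<^esub> s') t = ?op s t \<oplus>\<^bsub>?T\<^esub> ?op s' t" "?op t (s \<oplus>\<^bsub>?T\<^esub> s') = ?op t s \<oplus>\<^bsub>?T\<^esub> ?op t s'"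
    if "s \<in> carrier ?T" "s' \<in> carrier ?T" "t \<in> carrier ?T" for s s' t
    using tensor_op_bilinear[OF module_axioms module_axioms mult_bilinear mult_bilinear] that
    by (auto dest: bilinear_mapD linear_mapD(2))
  \<comment> \<open>\<open>?J\<close> absorbs products on both sides: each summand does, with H
    itself taken as the unit ideal (\<open>oneideal\<close>), and the product is additive in each
    argument.\<close>
  have opJ: "?op s t \<in> ?J" "?op t s \<in> ?J" if "s \<in> carrier ?T" "t \<in> ?J" for s t
  proof -
    obtain p q where pq: "p \<in> tensor_image R H ?I (carrier H)" "q \<in> tensor_image R H (carrier H) ?I"
      and t: "t = p \<oplus>\<^bsub>?T\<^esub> q"
      using \<open>t \<in> ?J\<close> by (auto simp: set_add_def')
    then have c: "p \<in> carrier ?T" "q \<in> carrier ?T" using img T.submoduleE(1) by blast+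
    show "?op s t \<in> ?J"
      unfolding t op_add(2)[OF c that(1)]
      by (intro set_addI mult_tensor_image_left Iid oneideal that(1) pq)
    show "?op t s \<in> ?J"
      unfolding t op_add(1)[OF c that(1)]
      by (intro set_addI mult_tensor_image_right Iid oneideal that(1) pq)
  qed
  let ?V = "{x \<in> carrier H. \<Delta> x \<in> ?J}"
  note Vsub = linear_map_vimage_submodule[OF module_axioms T.module_axioms comult_linear Jsub]
  \<comment> \<open>Multiplicativity of \<Delta> transfers the absorption property
    \<open>opJ\<close> from \<open>?J\<close> to its preimage.\<close>
  have "ideal ?V H"
    by (rule idealI[OF ring_axioms submodule.axioms(1)[OF Vsub]])
      (auto simp: comult_mult opJ linear_mapD(1)[OF comult_linear])
  moreover have "C \<subseteq> ?V"
  proof -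
    have "tensor_image R H C (carrier H) <+>\<^bsub>?T\<^esub> tensor_image R H (carrier H) C \<subseteq> ?J"
      by (intro set_add_mono tensor_image_mono module_axioms Csub Isub Hsub CI order_refl)
    then show ?thesis using C\<Delta> Cc by blast
  qed
  ultimately have "?I \<subseteq> ?V" by (rule genideal_minimal)
  moreover have "?I \<subseteq> a_kernel H R \<epsilon>" by (rule genideal_minimal[OF \<epsilon>.kernel_is_ideal Cker])
  ultimately show ?thesis using Iid Isub by (auto simp: biideal_def coideal_def)
qed

end

section \<open>Statement (a): the span of the values of \<open>vee \<alpha>\<close>\<close>

section \<open>The cocycle condition\<close>

context cocycle_vee_bialgebra
begin

text \<open>Applying \<open>\<epsilon> \<otimes> \<epsilon>\<close> to the cocycle condition gives \<open>\<epsilon> (h \<or> h') = \<epsilon> (h \<or> h') + \<epsilon> (h \<or> h')\<close>.\<close>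

lemma counit_vee:
  assumes \<alpha>: "\<alpha> \<in> \<Omega>" and h: "h \<in> carrier H" and h': "h' \<in> carrier H"
  shows "\<epsilon> (vee \<alpha> h h') = \<zero>\<^bsub>R\<^esub>"
proof -
  interpret \<epsilon>: ring_hom_ring H R \<epsilon>
    by (rule ring_hom_ringI2[OF ring_axioms R.ring_axioms counit_hom])
  let ?T = "tensor R H H" and ?S = "self_module R"
  note T = tensor_square_module and S = self_module_module[OF R.is_cring] and M = module_axioms
  interpret T: module R ?T by (rule T)
  note vee = vee_bilinear[OF \<alpha>]
  have S_simps: "carrier ?S = carrier R" "add ?S = add R" "smult ?S = mult R"
    by (auto simp: self_module_def)
  have \<epsilon>_smult: "\<epsilon> (r \<odot>\<^bsub>H\<^esub> x) = r \<otimes>\<^bsub>R\<^esub> \<epsilon> x" if "r \<in> carrier R" "x \<in> carrier H" for r x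
    using linear_mapD(3)[OF counit_linear that] by (simp add: S_simps)
  \<comment> \<open>\<phi> is \<epsilon> \<otimes> id followed by the scalar action; the counit law
    says that it undoes \<Delta>. Following it by \<epsilon> gives \<epsilon> \<otimes>
    \<epsilon>.\<close>
  define \<phi> where "\<phi> t = tensor_lift R H (\<lambda>r d. r \<odot>\<^bsub>H\<^esub> d) (tensor_map R ?S H \<epsilon> id t)" for t
  have act: "bilinear_map R ?S H H (\<lambda>r d. r \<odot>\<^bsub>H\<^esub> d)"
    by (intro bilinear_mapI linear_mapI)
      (auto simp: S_simps smult_l_distr smult_r_distr smult_assoc1[symmetric] R.m_comm)
  note act_lift = tensor_lift_universal[OF S M M act]
  note map = tensor_map_props[OF M M S M counit_linear linear_map_id]
  have \<phi>_linear: "linear_map R ?T H \<phi>"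
    unfolding \<phi>_def by (rule linear_map_compose[OF map(1) act_lift(1)])
  have \<phi>_tens: "\<phi> (tens R H H x y) = \<epsilon> x \<odot>\<^bsub>H\<^esub> y" if "x \<in> carrier H" "y \<in> carrier H" for x y
    using that by (simp add: \<phi>_def map(2) act_lift(2) S_simps)
  have \<phi>_\<Delta>: "\<phi> (\<Delta> x) = x" if "x \<in> carrier H" for x
    unfolding \<phi>_def by (rule counit_left[OF that])
  let ?op = "\<lambda>s t. tensor_op R H H (mult H) (vee \<alpha>) (tens R ?T ?T s t)"
  note op = tensor_op_props[OF M M mult_bilinear vee]
  have \<epsilon>\<phi>: "linear_map R ?T ?S (\<lambda>t. \<epsilon> (\<phi> t))"
    by (rule linear_map_compose[OF \<phi>_linear counit_linear])
  \<comment> \<open>Both sides are bilinear in s and t. On x \<otimes> y and z \<otimes> w both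
    equal \<epsilon>(x) \<epsilon>(z) \<epsilon>(y \<or> w), by multiplicativity of \<epsilon> on
    the left and by moving scalars out of \<open>vee \<alpha>\<close> on the right.\<close>
  have op_eq: "\<epsilon> (\<phi> (?op s t)) = \<epsilon> (vee \<alpha> (\<phi> s) (\<phi> t))" if "s \<in> carrier ?T" "t \<in> carrier ?T" for s t
  proof (rule bilinear_map_tensor_eqI[OF M M M M S _ _ _ that])
    show "bilinear_map R ?T ?T ?S (\<lambda>s t. \<epsilon> (\<phi> (?op s t)))"
      using bilinear_map_compose[OF linear_map_id linear_map_id op(1) \<epsilon>\<phi>] by simp
    show "bilinear_map R ?T ?T ?S (\<lambda>s t. \<epsilon> (vee \<alpha> (\<phi> s) (\<phi> t)))"
      by (rule bilinear_map_compose[OF \<phi>_linear \<phi>_linear vee counit_linear])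
    fix x y z w assume c: "x \<in> carrier H" "y \<in> carrier H" "z \<in> carrier H" "w \<in> carrier H"
    have v: "vee \<alpha> y w \<in> carrier H" by (rule bilinear_map_closed[OF vee c(2,4)])
    have "vee \<alpha> (\<epsilon> x \<odot>\<^bsub>H\<^esub> y) (\<epsilon> z \<odot>\<^bsub>H\<^esub> w) = \<epsilon> x \<odot>\<^bsub>H\<^esub> (\<epsilon> z \<odot>\<^bsub>H\<^esub> vee \<alpha> y w)"
      using c by (simp add: linear_mapD(3)[OF bilinear_mapD(1)[OF vee]] linear_mapD(3)[OF bilinear_mapD(2)[OF vee]]
        smult_assoc1[symmetric] v R.m_comm)
    then show "\<epsilon> (\<phi> (?op (tens R H H x y) (tens R H H z w))) = \<epsilon> (vee \<alpha> (\<phi> (tens R H H x y)) (\<phi> (tens R H H z w)))"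
      using c v by (simp add: op(2) \<phi>_tens \<epsilon>_smult R.m_assoc)
  qed
  define v where "v = vee \<alpha> h h'"
  have v: "v \<in> carrier H" unfolding v_def by (rule bilinear_map_closed[OF vee h h'])
  note \<Delta>c = linear_mapD(1)[OF comult_linear]
  have opc: "?op (\<Delta> h) (\<Delta> h') \<in> carrier ?T" by (rule bilinear_map_closed[OF op(1) \<Delta>c[OF h] \<Delta>c[OF h']])
  have "\<epsilon> v = \<epsilon> (\<phi> (\<Delta> v))" by (simp add: \<phi>_\<Delta> v)
  also have "\<Delta> v = tens R H H v \<one>\<^bsub>H\<^esub> \<oplus>\<^bsub>?T\<^esub> ?op (\<Delta> h) (\<Delta> h')"
    unfolding v_def by (rule cocycle[OF \<alpha> h h'])
  also have "\<epsilon> (\<phi> \<dots>) = \<epsilon> (\<phi> (tens R H H v \<one>\<^bsub>H\<^esub>)) \<oplus>\<^bsub>R\<^esub> \<epsilon> (\<phi> (?op (\<Delta> h) (\<Delta> h')))"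
    using linear_mapD(2)[OF \<epsilon>\<phi> tens_closed[OF M M v one_closed] opc] by (simp add: S_simps)
  \<comment> \<open>The first term uses \<epsilon>(1) = 1; the second uses \<open>op_eq\<close> and
    the fact that \<phi> undoes \<Delta>. Cancelling \<epsilon>(v) then gives zero.\<close>
  also have "\<dots> = \<epsilon> v \<oplus>\<^bsub>R\<^esub> \<epsilon> v"
    using v h h' by (simp add: op_eq \<Delta>c \<phi>_\<Delta> \<phi>_tens \<epsilon>_smult v_def[symmetric])
  finally show ?thesis using v by (simp add: v_def)
qed

lemma vee_span_coideal:
  assumes \<alpha>: "\<alpha> \<in> \<Omega>"
  shows "coideal R H \<Delta> \<epsilon> (module_span R H {vee \<alpha> h1 h2 | h1 h2. h1 \<in> carrier H \<and> h2 \<in> carrier H})"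
proof -
  let ?S = "{vee \<alpha> h1 h2 | h1 h2. h1 \<in> carrier H \<and> h2 \<in> carrier H}"
  let ?I = "module_span R H ?S" and ?T = "tensor R H H"
  let ?J = "tensor_image R H ?I (carrier H) <+>\<^bsub>?T\<^esub> tensor_image R H (carrier H) ?I"
  note M = module_axioms and T = tensor_square_module and vee = vee_bilinear[OF \<alpha>]
  have Sc: "?S \<subseteq> carrier H" by (auto intro: bilinear_map_closed[OF vee])
  note Isub = span_submodule(1)[OF M Sc] and SI = span_submodule(2)[OF M Sc] and Hsub = carrier_is_submodule
  have min: "?I \<subseteq> L" if "submodule L R H" "?S \<subseteq> L" for L
    using that by (auto simp: module_span_def)
  note img = tensor_image_submodule[OF M Isub Hsub] tensor_image_submodule[OF M Hsub Isub]
  note Jsub = submodule_set_add[OF T img] and sub = submodule_subset_set_add[OF T img]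
  have "?I \<subseteq> {x \<in> carrier H. \<Delta> x \<in> ?J}"
  proof (rule min[OF linear_map_vimage_submodule[OF M T comult_linear Jsub]], clarify)
    fix h h' assume h: "h \<in> carrier H" "h' \<in> carrier H"
    note \<Delta>c = linear_mapD(1)[OF comult_linear]
    have v: "vee \<alpha> h h' \<in> ?I" using SI h by blast
    have "tens R H H (vee \<alpha> h h') \<one>\<^bsub>H\<^esub> \<in> ?J"
      using tens_in_tensor_image[OF M Isub Hsub v one_closed] sub(1) by blast
    \<comment> \<open>The left factors are products and lie in H, while every value of
      \<open>vee \<alpha>\<close> in the right factor lies in the span.\<close>
    moreover have "tensor_op R H H (mult H) (vee \<alpha>) (tens R ?T ?T (\<Delta> h) (\<Delta> h')) \<in> tensor_image R H (carrier H) ?I"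
      by (rule tensor_op_tensor_image[OF M mult_bilinear vee Hsub Hsub Hsub Hsub Hsub Isub])
        (use h SI in \<open>auto simp: tensor_image_carrier[OF M] \<Delta>c\<close>)
    ultimately have "\<Delta> (vee \<alpha> h h') \<in> ?J"
      unfolding cocycle[OF \<alpha> h] using module.submoduleE(5)[OF T Jsub] sub(2) by blast
    then show "vee \<alpha> h h' \<in> carrier H \<and> \<Delta> (vee \<alpha> h h') \<in> ?J"
      using bilinear_map_closed[OF vee h] by blast
  qed
  moreover have "?I \<subseteq> a_kernel H R \<epsilon>"
  proof (rule min)
    \<comment> \<open>Linearity of \<epsilon> makes its kernel a submodule, so only the generators,
      covered by \<open>counit_vee\<close>, need checking.\<close>
    show "submodule (a_kernel H R \<epsilon>) R H"
      using linear_ker[OF M self_module_module[OF R.is_cring] counit_linear]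
      by (simp add: a_kernel_def' self_module_def)
    show "?S \<subseteq> a_kernel H R \<epsilon>"
      using counit_vee[OF \<alpha>] bilinear_map_closed[OF vee] by (auto simp: a_kernel_def')
  qed
  ultimately show ?thesis using Isub by (auto simp: coideal_def)
qed

end

theorem proposition3p8:
  fixes R :: "('k, 'r) ring_scheme"
    and H :: "('k, 'h, 'm) module_scheme"
    and \<Delta> :: "'h \<Rightarrow> ('h \<times> 'h \<Rightarrow> 'k) set"
    and \<epsilon> :: "'h \<Rightarrow> 'k"
    and \<Omega> :: "'w set"
    and vee :: "'w \<Rightarrow> 'h \<Rightarrow> 'h \<Rightarrow> 'h"
    and C :: "'h set"
  assumes "\<Omega> \<noteq> {}"
    and "cocycle_vee_bialgebra R H \<Delta> \<epsilon> \<Omega> vee"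
    and "coideal R H \<Delta> \<epsilon> C"
  shows "(\<forall>\<alpha>\<in>\<Omega>. coideal R H \<Delta> \<epsilon>
            (module_span R H {vee \<alpha> h1 h2 | h1 h2. h1 \<in> carrier H \<and> h2 \<in> carrier H}))
         \<and> biideal R H \<Delta> \<epsilon> (Idl\<^bsub>H\<^esub> C)"
proof -
  interpret cocycle_vee_bialgebra R H \<Delta> \<epsilon> \<Omega> vee by fact
  show ?thesis using vee_span_coideal genideal_biideal[OF assms(3)] by blast
qed

end
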